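(* Fix $m\in\mathbb{N}$. Let $k=k(n)$ be a sequence of integers with $k(n)\ge m$ for all $n$, such that, as $n\to\infty$, $k(n)=o(\log n)$ if $m=1$, and $k(n)=o\left(\frac{\log n}{\log\log n}\right)$ if $m\ge 2$. Then, as $n\to\infty$, $$\frac{k!\,S_k}{(\log n)^{k-m+1}}$$ converges in distribution to $\mathrm{Exp}\left(\frac{1}{(m-1)!}\right)$.
   Context: Coupon collector problem: there are $n$ types of coupons. Coupons are collected one at a time; each collected coupon is, independently of the others, of each given type with probability $1/n$. Fix a positive integer $m$. One keeps collecting until at least $m$ copies of every one of the $n$ types have been collected, and then stops. For an integer $k\ge m$, a type of coupon is called a $k$-ton if exactly $k$ copies of it have been collected at the stopping time, and $S_k$ (which depends on $n$ and $m$) denotes the number of types that are $k$-tons. $\mathbb{N}$ denotes the positive integers and $\log$ the natural logarithm. $\mathrm{Exp}(\lambda)$ denotes the exponential distribution with rate $\lambda$, i.e. with cumulative distribution function $r\mapsto 1-e^{-\lambda r}$ for $r\ge 0$. *)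

theory Defs
  imports "HOL-Probability.Probability" "HOL-Library.Landau_Symbols"
begin

text \<open>The \<open>n\<close> coupon types are labelled \<open>0, \<dots>, n - 1\<close>, and \<open>C t\<close> is the type of the \<open>t\<close>-th
  collected coupon, counting from \<open>t = 0\<close>; it lies outside \<open>{..<n}\<close> with probability zero.\<close>

locale coupon_collector = prob_space M for M :: "'a measure" +
  fixes n :: nat and C :: "nat \<Rightarrow> 'a \<Rightarrow> nat"
  assumes indep_coupons: "indep_vars (\<lambda>_. count_space UNIV) C UNIV"
    and uniform_coupons: "\<And>t i. i < n \<Longrightarrow> prob {\<omega> \<in> space M. C t \<omega> = i} = 1 / real n"

definition copies :: "(nat \<Rightarrow> nat) \<Rightarrow> nat \<Rightarrow> nat \<Rightarrow> nat" where
  "copies x t i = card {s. s < t \<and> x s = i}"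

text \<open>The number of coupons drawn when collecting stops. On the null set of sequences along which
  collecting never stops, this is an unspecified natural number.\<close>

definition collection_time :: "nat \<Rightarrow> nat \<Rightarrow> (nat \<Rightarrow> nat) \<Rightarrow> nat" where
  "collection_time m n x = (LEAST t. \<forall>i<n. m \<le> copies x t i)"

definition num_tons :: "nat \<Rightarrow> nat \<Rightarrow> nat \<Rightarrow> (nat \<Rightarrow> nat) \<Rightarrow> nat" where
  "num_tons m n k x = card {i. i < n \<and> copies x (collection_time m n x) i = k}"

end

theory Submission
  imports Defs "HOL-Combinatorics.Multiset_Permutations" "HOL-Real_Asymp.Real_Asymp"
begin

text \<open>
  Let \<open>A j t\<close> be the number of types with at most \<open>j\<close> copies after \<open>t\<close> draws and \<open>T\<close> the collection time.
  The number of \<open>k\<close>-tons is \<open>A k T - A (k - 1) T\<close>, and \<open>T \<le> t\<close> holds iff \<open>A (m - 1) t = 0\<close>. Both facts are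
  useful because \<open>A j t\<close> is decreasing in \<open>t\<close>, while the number of types with exactly \<open>k\<close> copies is not
  monotone.

  After \<open>n s\<close> draws with \<open>s = ln n + (m - 1) ln (ln n) - ln ((m - 1)! l)\<close>, about \<open>l\<close> types are incomplete on
  average, and completion has probability close to \<open>exp (- l)\<close> (\<open>completion_limit\<close>). At the same time
  \<open>A k\<close>, multiplied by \<open>k! / (ln n) ^ (k - m + 1)\<close>, concentrates at \<open>(m - 1)! l\<close>
  (\<open>rare_types_concentration\<close>), whereas \<open>A (k - 1)\<close> is smaller by a factor of order \<open>k / ln n\<close> and is negligible
  on this scale (\<open>rarer_types_negligible\<close>). The growth conditions on \<open>k\<close> say that \<open>s ^ k\<close> is asymptotic to
  \<open>(ln n) ^ k\<close>, so that the deterministic normalization is the right one. Consequently the normalized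
  number of \<open>k\<close>-tons is at most \<open>y\<close> essentially iff collecting is not complete at the time with parameter
  \<open>l = y / (m - 1)!\<close>, which has probability close to \<open>1 - exp (- l)\<close>. By monotonicity of \<open>A\<close>, only finitely many
  fixed times have to be examined (\<open>num_tons_prob_ge\<close>, \<open>num_tons_prob_le\<close>, \<open>num_tons_limit\<close>).

  The probabilities at fixed times are found by Poissonization (\<open>poissonization\<close>): after a Poisson number of
  draws with mean \<open>n s\<close> the counts are independent Poisson variables, so \<open>A j\<close> is binomial, and elementary
  limits and Chebyshev's inequality suffice. The events used are monotone in the number of draws, and a Poisson
  variable of mean \<open>n s\<close> fluctuates by much less than \<open>n\<close>, whereas changing \<open>l\<close> slightly moves \<open>n s\<close> by a
  multiple of \<open>n\<close>. Hence the limits carry over to deterministic numbers of draws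
  (\<open>rare_prob_depoissonization\<close>, \<open>rare_prob_limit\<close>).
\<close>

section \<open>Deviations of Poisson and binomial variables\<close>

lemma sums_measure_pmf_nat:
  fixes p :: "nat pmf" and f :: "nat \<Rightarrow> real"
  assumes "(\<lambda>j. pmf p j * f j) sums s" and "\<And>j. 0 \<le> f j"
  shows "integrable (measure_pmf p) f" and "measure_pmf.expectation p f = s"
proof -
  have int: "integrable (count_space UNIV) (\<lambda>j. pmf p j *\<^sub>R f j)"
    using assms by (auto simp: integrable_count_space_nat_iff sums_iff)
  show "integrable (measure_pmf p) f"
    unfolding measure_pmf_eq_density using int by (subst integrable_density) auto
  have "measure_pmf.expectation p f = (\<integral>j. pmf p j *\<^sub>R f j \<partial>count_space UNIV)"
    unfolding measure_pmf_eq_density by (subst integral_density) auto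
  also have "\<dots> = s"
    using integral_count_space_nat[OF int] assms(1) by (simp add: sums_iff)
  finally show "measure_pmf.expectation p f = s" .
qed

lemma poisson_second_moment:
  fixes \<mu> :: real
  assumes "0 < \<mu>"
  shows "(\<lambda>j. pmf (poisson_pmf \<mu>) j * (real j - \<mu>)\<^sup>2) sums \<mu>"
proof -
  define a where "a = (\<lambda>j::nat. \<mu> ^ j / fact j)"
  have a: "a sums exp \<mu>"
    using exp_converges[of \<mu>] by (simp add: a_def field_simps scaleR_conv_of_real)
  have shift: "real (Suc j) * a (Suc j) = \<mu> * a j" for j
    by (simp add: a_def divide_simps)
  have "(\<lambda>j. real (Suc j) * a (Suc j)) sums (\<mu> * exp \<mu>)"
    unfolding shift using a by (rule sums_mult)
  then have first: "(\<lambda>j. real j * a j) sums (\<mu> * exp \<mu>)"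
    using sums_Suc[of "\<lambda>j. real j * a j"] by simp
  have "(\<lambda>j. \<mu> * (real j * a j + a j)) sums (\<mu> * (\<mu> * exp \<mu> + exp \<mu>))"
    by (intro sums_mult sums_add first a)
  moreover have "\<mu> * (real j * a j + a j) = (real (Suc j))\<^sup>2 * a (Suc j)" for j
  proof -
    have "(real (Suc j))\<^sup>2 * a (Suc j) = real (Suc j) * (\<mu> * a j)"
      by (simp only: power2_eq_square mult.assoc shift)
    then show ?thesis
      by (simp add: algebra_simps)
  qed
  ultimately have "(\<lambda>j. (real (Suc j))\<^sup>2 * a (Suc j)) sums (\<mu> * (\<mu> * exp \<mu> + exp \<mu>))"
    by simp
  then have second: "(\<lambda>j. (real j)\<^sup>2 * a j) sums (\<mu> * (\<mu> * exp \<mu> + exp \<mu>))"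
    using sums_Suc[of "\<lambda>j. (real j)\<^sup>2 * a j"] by simp
  have "(\<lambda>j. exp (-\<mu>) * ((real j)\<^sup>2 * a j - 2 * \<mu> * (real j * a j) + \<mu>\<^sup>2 * a j)) sums
      (exp (-\<mu>) * (\<mu> * (\<mu> * exp \<mu> + exp \<mu>) - 2 * \<mu> * (\<mu> * exp \<mu>) + \<mu>\<^sup>2 * exp \<mu>))"
    by (intro sums_mult sums_add sums_diff first second a)
  also have "exp (-\<mu>) * (\<mu> * (\<mu> * exp \<mu> + exp \<mu>) - 2 * \<mu> * (\<mu> * exp \<mu>) + \<mu>\<^sup>2 * exp \<mu>) = \<mu>"
    by (simp add: exp_minus field_simps power2_eq_square)
  finally show ?thesis
    using assms by (simp add: a_def power2_eq_square algebra_simps diff_divide_distrib add_divide_distrib)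
qed

lemma poisson_deviation:
  fixes \<mu> d :: real
  assumes "0 < \<mu>" "0 < d"
  shows "measure_pmf.prob (poisson_pmf \<mu>) {j. d \<le> \<bar>real j - \<mu>\<bar>} \<le> \<mu> / d\<^sup>2"
proof -
  note mom = sums_measure_pmf_nat[OF poisson_second_moment[OF assms(1)], simplified]
  show ?thesis
    using measure_pmf.second_moment_method[of "\<lambda>j. real j - \<mu>" "poisson_pmf \<mu>" d] mom assms by simp
qed

text \<open>The variance is read off from the first two factorial moments of the Bernstein polynomials. The bound
  \<open>n p / d\<^sup>2\<close>, rather than \<open>n / d\<^sup>2\<close>, is what makes the deviations negligible when \<open>p\<close> is small.\<close>

lemma binomial_deviation:
  fixes p d :: real
  assumes p: "p \<in> {0..1}" and d: "0 < d"
  shows "measure_pmf.prob (binomial_pmf n p) {j. d \<le> \<bar>real j - real n * p\<bar>} \<le> real n * p / d\<^sup>2"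
proof -
  define V where "V = measure_pmf.expectation (binomial_pmf n p) (\<lambda>j. (real j - real n * p)\<^sup>2)"
  have "V = (\<Sum>j\<le>n. real j * (real j - 1) * Bernstein n j p
       + (1 - 2 * (real n * p)) * (real j * Bernstein n j p) + (real n * p)\<^sup>2 * Bernstein n j p)"
    unfolding V_def expectation_binomial_pmf'[OF p]
    by (intro sum.cong) (auto simp: Bernstein_def power2_eq_square algebra_simps)
  also have "\<dots> = real n * (real n - 1) * p\<^sup>2 + (1 - 2 * (real n * p)) * (real n * p) + (real n * p)\<^sup>2"
    by (simp only: sum.distrib sum_distrib_left[symmetric] sum_kk_Bernstein sum_k_Bernstein sum_Bernstein)
  also have "\<dots> = real n * p - real n * p\<^sup>2"
    by (simp add: power2_eq_square algebra_simps)
  also have "\<dots> \<le> real n * p"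
    by simp
  finally have "V / d\<^sup>2 \<le> real n * p / d\<^sup>2"
    by (simp add: divide_right_mono)
  then show ?thesis
    using measure_pmf.second_moment_method[of "\<lambda>j. real j - real n * p" "binomial_pmf n p" d] p d
    by (simp add: V_def integrable_binomial_pmf)
qed

section \<open>Poissonization of the counts\<close>

definition words :: "nat \<Rightarrow> nat \<Rightarrow> nat list set" where
  "words n t = {xs. set xs \<subseteq> {..<n} \<and> length xs = t}"

text \<open>The joint law of the numbers of copies of all types after \<open>t\<close> draws (a multinomial law).\<close>

definition uniform_counts :: "nat \<Rightarrow> nat \<Rightarrow> (nat \<Rightarrow> nat) pmf" where
  "uniform_counts n t = map_pmf (\<lambda>xs. count (mset xs)) (pmf_of_set (words n t))"

lemma words_simps: "finite (words n t)" "card (words n t) = n ^ t" "0 < n \<Longrightarrow> words n t \<noteq> {}"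
proof -
  show "finite (words n t)" "card (words n t) = n ^ t"
    using finite_lists_length_eq[of "{..<n}" t] card_lists_length_eq[of "{..<n}" t]
    by (simp_all add: words_def)
  then show "words n t \<noteq> {}" if "0 < n"
    using that by (metis card.empty power_not_zero less_not_refl)
qed

text \<open>A word with letter counts \<open>a\<close> is a permutation of the multiset with multiplicities \<open>a\<close>, so there are
  multinomially many of them.\<close>

lemma card_words_counts:
  assumes "\<And>i. i \<ge> n \<Longrightarrow> a i = 0"
  shows "real (card {xs \<in> words n t. count (mset xs) = a}) =
    (if t = (\<Sum>i<n. a i) then fact t / (\<Prod>i<n. fact (a i)) else 0)"
proof -
  define A where "A = Abs_multiset a"
  have A: "count A = a"
  proof -
    have "finite {i. 0 < a i}"
      by (rule finite_subset[of _ "{..<n}"]) (use assms in \<open>force simp: not_less[symmetric]\<close>)+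
    then show ?thesis
      unfolding A_def by (simp add: count_Abs_multiset)
  qed
  have sub: "set_mset A \<subseteq> {..<n}"
  proof
    fix i assume "i \<in> set_mset A"
    then have "a i \<noteq> 0" by (simp flip: A)
    then show "i \<in> {..<n}" using assms[of i] by force
  qed
  have size: "size A = (\<Sum>i<n. a i)"
    unfolding size_multiset_overloaded_eq A
    by (rule sum.mono_neutral_left) (use sub A in \<open>auto simp: set_mset_def\<close>)
  have fact: "(\<Prod>i\<in>set_mset A. fact (count A i)) = (\<Prod>i<n. fact (a i) :: nat)"
    unfolding A by (rule prod.mono_neutral_left) (use sub A in \<open>auto simp: set_mset_def\<close>)
  have "{xs \<in> words n t. count (mset xs) = a} = (if t = size A then permutations_of_multiset A else {})"
  proof -
    have "count (mset xs) = a \<longleftrightarrow> mset xs = A" for xs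
      unfolding A[symmetric] by (simp add: count_inject)
    moreover have "set xs \<subseteq> {..<n} \<and> length xs = size A" if "mset xs = A" for xs
      using sub that by auto
    ultimately show ?thesis
      by (auto simp: words_def permutations_of_multiset_def)
  qed
  moreover have "real (card (permutations_of_multiset A)) = fact (size A) / (\<Prod>i<n. fact (a i))"
    using arg_cong[OF card_permutations_of_multiset_aux[of A], of real]
    by (simp add: fact field_simps)
  ultimately show ?thesis
    by (simp add: size)
qed

lemma pmf_uniform_counts:
  assumes "0 < n"
  shows "pmf (uniform_counts n t) a =
    (if (\<forall>i\<ge>n. a i = 0) \<and> t = (\<Sum>i<n. a i) then fact t / (\<Prod>i<n. fact (a i)) / real n ^ t else 0)"
proof -
  have eq: "pmf (uniform_counts n t) a = real (card {xs \<in> words n t. count (mset xs) = a}) / real n ^ t"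
    using assms
    by (simp add: uniform_counts_def pmf_map measure_pmf_of_set words_simps vimage_def Int_def conj_commute)
  show ?thesis
  proof (cases "\<forall>i\<ge>n. a i = 0")
    case True
    then show ?thesis
      using card_words_counts[of n a t] by (simp add: eq)
  next
    case False
    then obtain i where i: "n \<le> i" "a i \<noteq> 0"
      by blast
    have "count (mset xs) i = 0" if "xs \<in> words n t" for xs
      using that i by (force simp: words_def count_eq_zero_iff)
    then have "{xs \<in> words n t. count (mset xs) = a} = {}"
      using i by auto
    then have "pmf (uniform_counts n t) a = 0"
      unfolding eq by (simp only: card.empty)
    then show ?thesis
      using False by auto
  qed
qed

text \<open>If the number of draws is Poisson distributed with mean \<open>n s\<close>, the counts of the \<open>n\<close> types become
  independent Poisson variables of mean \<open>s\<close>: at a given count vector only one value of the number of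
  draws contributes, and its factorial cancels against the multinomial coefficient.\<close>

lemma poissonization:
  assumes n: "0 < n" and s: "0 < s"
  shows "bind_pmf (poisson_pmf (real n * s)) (uniform_counts n) = Pi_pmf {..<n} 0 (\<lambda>_. poisson_pmf s)"
proof (rule pmf_eqI)
  fix a :: "nat \<Rightarrow> nat"
  define t where "t = (\<Sum>i<n. a i)"
  define c where "c = pmf (uniform_counts n t) a"
  have "pmf (uniform_counts n j) a = c * indicator {t} j" for j
    by (auto simp: c_def pmf_uniform_counts[OF n] t_def indicator_def)
  then have "pmf (bind_pmf (poisson_pmf (real n * s)) (uniform_counts n)) a =
      pmf (poisson_pmf (real n * s)) t * c"
    by (simp add: pmf_bind measure_pmf_single)
  also have "\<dots> = pmf (Pi_pmf {..<n} 0 (\<lambda>_. poisson_pmf s)) a"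
  proof (cases "\<forall>i\<ge>n. a i = 0")
    case True
    have "(\<Prod>i<n. s ^ a i / fact (a i) * exp (- s)) = s ^ t / (\<Prod>i<n. fact (a i)) * exp (- s) ^ n"
      by (simp add: prod.distrib prod_dividef power_sum t_def)
    then show ?thesis
      using True n s by (simp add: c_def pmf_uniform_counts pmf_Pi t_def[symmetric]
          power_mult_distrib not_less exp_of_nat_mult[symmetric] field_simps)
  next
    case False
    then show ?thesis
      using n s by (auto simp: c_def pmf_uniform_counts pmf_Pi not_less)
  qed
  finally show "pmf (bind_pmf (poisson_pmf (real n * s)) (uniform_counts n)) a =
      pmf (Pi_pmf {..<n} 0 (\<lambda>_. poisson_pmf s)) a" .
qed

text \<open>Unlike the number of types with exactly \<open>j\<close> copies, this number can only decrease as coupons are drawn.\<close>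

definition rare_types :: "nat \<Rightarrow> nat \<Rightarrow> (nat \<Rightarrow> nat) \<Rightarrow> nat" where
  "rare_types n j a = card {i. i < n \<and> a i \<le> j}"

definition poisson_cdf :: "real \<Rightarrow> nat \<Rightarrow> real" where
  "poisson_cdf s j = measure_pmf.prob (poisson_pmf s) {..j}"

lemma poisson_cdf_in_unit: "poisson_cdf s j \<in> {0..1}"
  by (simp add: poisson_cdf_def)

lemma rare_types_antimono: "a \<le> b \<Longrightarrow> rare_types n j b \<le> rare_types n j a"
  unfolding rare_types_def
proof (rule card_mono)
  assume "a \<le> b"
  then have "a i \<le> j" if "b i \<le> j" for i
    using that le_funD order_trans by metis
  then show "{i. i < n \<and> b i \<le> j} \<subseteq> {i. i < n \<and> a i \<le> j}"
    by blast
qed simp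

text \<open>Under Poissonization the types are rare independently of each other.\<close>

lemma map_pmf_rare_types_poisson:
  assumes "0 < s"
  shows "map_pmf (rare_types n j) (Pi_pmf {..<n} 0 (\<lambda>_. poisson_pmf s)) = binomial_pmf n (poisson_cdf s j)"
proof -
  have bern: "map_pmf (\<lambda>x. x \<le> j) (poisson_pmf s) = bernoulli_pmf (poisson_cdf s j)"
  proof (rule pmf_eqI)
    fix b :: bool
    have "(\<lambda>x. x \<le> j) -` {False} = - {..j}" "(\<lambda>x. x \<le> j) -` {True} = {..j}"
      by (simp_all add: set_eq_iff not_le)
    then show "pmf (map_pmf (\<lambda>x. x \<le> j) (poisson_pmf s)) b = pmf (bernoulli_pmf (poisson_cdf s j)) b"
      using poisson_cdf_in_unit[of s j] measure_pmf.prob_compl[of "{..j}" "poisson_pmf s"]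
      by (cases b) (simp_all add: pmf_map poisson_cdf_def Compl_eq_Diff_UNIV)
  qed
  have "binomial_pmf n (poisson_cdf s j) =
      map_pmf (\<lambda>f. card {i \<in> {..<n}. f i})
        (Pi_pmf {..<n} True (\<lambda>_. map_pmf (\<lambda>x. x \<le> j) (poisson_pmf s)))"
    unfolding bern by (rule binomial_pmf_altdef') (auto simp: poisson_cdf_in_unit[simplified])
  also have "Pi_pmf {..<n} True (\<lambda>_. map_pmf (\<lambda>x. x \<le> j) (poisson_pmf s)) =
      map_pmf (\<lambda>h. (\<lambda>x. x \<le> j) \<circ> h) (Pi_pmf {..<n} 0 (\<lambda>_. poisson_pmf s))"
    by (rule Pi_pmf_map) auto
  finally show ?thesis
    by (simp add: pmf.map_comp rare_types_def[abs_def] o_def)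
qed

section \<open>The coupon process\<close>

lemma copies_conv_count: "copies x t = count (mset (map x [0..<t]))"
proof
  fix i
  have "copies x t i = length (filter (\<lambda>y. i = y) (map x [0..<t]))"
    unfolding copies_def length_filter_conv_card by (rule arg_cong[where f = card]) auto
  then show "copies x t i = count (mset (map x [0..<t])) i"
    by (simp only: count_mset count_list_eq_length_filter)
qed

lemma copies_mono: "t \<le> t' \<Longrightarrow> copies x t \<le> copies x t'"
  unfolding copies_def
proof (rule le_funI, rule card_mono)
  assume "t \<le> t'"
  fix i
  show "finite {s. s < t' \<and> x s = i}"
    by simp
  show "{s. s < t \<and> x s = i} \<subseteq> {s. s < t' \<and> x s = i}"
    using \<open>t \<le> t'\<close> less_le_trans by blast
qed

context coupon_collector
begin

lemma coupon_measurable [measurable]: "C t \<in> M \<rightarrow>\<^sub>M count_space UNIV"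
  using indep_coupons unfolding indep_vars_def by blast

lemma word_measurable [measurable]: "(\<lambda>\<omega>. map (\<lambda>s. C s \<omega>) [0..<t]) \<in> M \<rightarrow>\<^sub>M count_space UNIV"
proof -
  have "(\<lambda>\<omega>. map (\<lambda>s. C s \<omega>) [0..<t]) -` {xs} \<inter> space M \<in> sets M" for xs
  proof (cases "length xs = t")
    case True
    then have "(\<lambda>\<omega>. map (\<lambda>s. C s \<omega>) [0..<t]) -` {xs} \<inter> space M =
        {\<omega> \<in> space M. \<forall>s<t. C s \<omega> = xs ! s}"
      by (simp add: list_eq_iff_nth_eq vimage_def Int_def conj_commute)
    then show ?thesis
      by simp
  next
    case False
    then have "(\<lambda>\<omega>. map (\<lambda>s. C s \<omega>) [0..<t]) -` {xs} \<inter> space M = {}"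
      by (simp add: list_eq_iff_nth_eq vimage_def)
    then show ?thesis
      by simp
  qed
  then show ?thesis
    by (simp add: measurable_count_space_eq2_countable)
qed

lemma prob_word:
  assumes "xs \<in> words n t"
  shows "prob {\<omega> \<in> space M. map (\<lambda>s. C s \<omega>) [0..<t] = xs} = 1 / real n ^ t"
proof (cases "t = 0")
  case True
  then show ?thesis
    using assms by (simp add: words_def prob_space)
next
  case False
  have len: "length xs = t" and lt: "\<And>s. s < t \<Longrightarrow> xs ! s < n"
    using assms by (auto simp: words_def subset_iff)
  have "{\<omega> \<in> space M. map (\<lambda>s. C s \<omega>) [0..<t] = xs} = (\<Inter>s\<in>{..<t}. C s -` {xs ! s} \<inter> space M)"
    using False len by (auto simp: list_eq_iff_nth_eq)
  also have "prob \<dots> = (\<Prod>s\<in>{..<t}. prob (C s -` {xs ! s} \<inter> space M))"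
    using False by (intro indep_varsD[OF indep_coupons]) auto
  also have "\<dots> = (\<Prod>s\<in>{..<t}. 1 / real n)"
  proof (rule prod.cong[OF refl])
    fix s assume "s \<in> {..<t}"
    moreover have "C s -` {xs ! s} \<inter> space M = {\<omega> \<in> space M. C s \<omega> = xs ! s}"
      by auto
    ultimately show "prob (C s -` {xs ! s} \<inter> space M) = 1 / real n"
      using uniform_coupons lt by simp
  qed
  finally show ?thesis
    by (simp add: power_divide)
qed

text \<open>Words of length \<open>t\<close> over the \<open>n\<close> types exhaust the probability, because there are \<open>n ^ t\<close> of them, each
  with probability \<open>1 / n ^ t\<close>; so values of \<open>C\<close> outside the range of types have probability zero.\<close>

lemma distr_word:
  assumes "0 < n"
  shows "prob {\<omega> \<in> space M. map (\<lambda>s. C s \<omega>) [0..<t] \<in> A} = measure_pmf.prob (pmf_of_set (words n t)) A"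
proof -
  let ?W = "\<lambda>\<omega>. map (\<lambda>s. C s \<omega>) [0..<t]"
  note W = words_simps[of n t]
  have sum: "prob {\<omega> \<in> space M. ?W \<omega> \<in> B} = real (card B) / real n ^ t" if "B \<subseteq> words n t" for B
  proof -
    have "finite B"
      using that W(1) finite_subset by blast
    moreover have "{\<omega> \<in> space M. ?W \<omega> \<in> B} = (\<Union>xs\<in>B. {\<omega> \<in> space M. ?W \<omega> = xs})"
      by auto
    ultimately have "prob {\<omega> \<in> space M. ?W \<omega> \<in> B} = (\<Sum>xs\<in>B. prob {\<omega> \<in> space M. ?W \<omega> = xs})"
      by (simp only:) (rule finite_measure_finite_Union, auto simp: disjoint_family_on_def)
    also have "\<dots> = (\<Sum>xs\<in>B. 1 / real n ^ t)"
      using that by (intro sum.cong) (auto intro: prob_word)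
    finally show ?thesis
      by simp
  qed
  have one: "prob {\<omega> \<in> space M. ?W \<omega> \<in> words n t} = 1"
    using sum[of "words n t"] W(2) assms by simp
  then have "prob {\<omega> \<in> space M. ?W \<omega> \<in> A} = prob {\<omega> \<in> space M. ?W \<omega> \<in> words n t \<inter> A}"
    using prob_eq_1[of "{\<omega> \<in> space M. ?W \<omega> \<in> words n t}"]
    by (intro finite_measure_eq_AE) auto
  also have "\<dots> = measure_pmf.prob (pmf_of_set (words n t)) A"
    using sum[of "words n t \<inter> A"] W assms by (simp add: measure_pmf_of_set)
  finally show ?thesis .
qed

lemma prob_copies:
  assumes "0 < n"
  shows "prob {\<omega> \<in> space M. copies (\<lambda>t. C t \<omega>) t \<in> A} = measure_pmf.prob (uniform_counts n t) A"
  using distr_word[OF assms, of t "(\<lambda>xs. count (mset xs)) -` A"]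
  by (simp add: copies_conv_count uniform_counts_def)

lemma copies_fun_measurable:
  "(\<lambda>\<omega>. F (copies (\<lambda>t. C t \<omega>) t)) \<in> M \<rightarrow>\<^sub>M count_space UNIV"
proof -
  have "(\<lambda>xs. F (count (mset xs))) \<circ> (\<lambda>\<omega>. map (\<lambda>s. C s \<omega>) [0..<t]) \<in> M \<rightarrow>\<^sub>M count_space UNIV"
    by (rule measurable_comp[OF word_measurable]) simp
  then show ?thesis
    by (simp add: copies_conv_count o_def)
qed

lemma rare_measurable [measurable]:
  "{\<omega> \<in> space M. real (rare_types n j (copies (\<lambda>t. C t \<omega>) t)) \<le> z} \<in> events"
  using copies_fun_measurable[of "\<lambda>a. real (rare_types n j a) \<le> z" t] by simp

definition rare_prob :: "nat \<Rightarrow> real \<Rightarrow> nat \<Rightarrow> real" where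
  "rare_prob j z t = prob {\<omega> \<in> space M. real (rare_types n j (copies (\<lambda>t. C t \<omega>) t)) \<le> z}"

text \<open>Since \<open>rare_types\<close> decreases with the number of draws, the event that it is at most \<open>z\<close> grows. This
  monotonicity is the basis of the de-Poissonization below.\<close>

lemma rare_prob_mono: "t \<le> t' \<Longrightarrow> rare_prob j z t \<le> rare_prob j z t'"
  unfolding rare_prob_def
proof (rule finite_measure_mono)
  assume "t \<le> t'"
  then have "real (rare_types n j (copies x t')) \<le> real (rare_types n j (copies x t))" for x
    by (intro of_nat_mono rare_types_antimono copies_mono)
  then show "{\<omega> \<in> space M. real (rare_types n j (copies (\<lambda>t. C t \<omega>) t)) \<le> z}
      \<subseteq> {\<omega> \<in> space M. real (rare_types n j (copies (\<lambda>t. C t \<omega>) t')) \<le> z}"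
    using order_trans by blast
qed simp

lemma expectation_rare_prob:
  assumes n: "0 < n" and s: "0 < s"
  shows "measure_pmf.expectation (poisson_pmf (real n * s)) (rare_prob j z) =
    measure_pmf.prob (binomial_pmf n (poisson_cdf s j)) {r. real r \<le> z}"
proof -
  let ?U = "{a. real (rare_types n j a) \<le> z}"
  have "rare_prob j z = (\<lambda>t. measure_pmf.prob (uniform_counts n t) ?U)"
  proof
    show "rare_prob j z t = measure_pmf.prob (uniform_counts n t) ?U" for t
      using prob_copies[OF n, of t ?U] by (simp add: rare_prob_def)
  qed
  then have "measure_pmf.expectation (poisson_pmf (real n * s)) (rare_prob j z) =
      measure_pmf.prob (bind_pmf (poisson_pmf (real n * s)) (uniform_counts n)) ?U"
    unfolding measure_pmf_bind
    by (subst measure_pmf.measure_bind[where N = "count_space UNIV"]) (auto simp: measure_pmf_in_subprob_algebra)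
  also have "\<dots> = measure_pmf.prob (map_pmf (rare_types n j) (Pi_pmf {..<n} 0 (\<lambda>_. poisson_pmf s)))
      {r. real r \<le> z}"
    unfolding poissonization[OF n s] by (simp add: vimage_def)
  finally show ?thesis
    unfolding map_pmf_rare_types_poisson[OF s] .
qed

lemma rare_prob_bounds: "0 \<le> rare_prob j z t" "rare_prob j z t \<le> 1"
  by (simp_all add: rare_prob_def)

text \<open>The Poissonized probability \<open>g\<close> is the average of \<open>rare_prob j z\<close> over a Poisson variable of mean
  \<open>n s\<close>. By monotonicity, up to the probability that this variable deviates from its mean by at least \<open>d\<close>,
  the average is at most the value at any \<open>t\<close> beyond \<open>n s + d\<close> and at least the value at any \<open>t\<close> below
  \<open>n s - d\<close>.\<close>

lemma rare_prob_depoissonization: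
  fixes s d z :: real and j :: nat
  assumes n: "0 < n" and s: "0 < s" and d: "0 < d"
  defines "g \<equiv> measure_pmf.prob (binomial_pmf n (poisson_cdf s j)) {r. real r \<le> z}"
  shows "real n * s + d \<le> real t \<Longrightarrow> g - real n * s / d\<^sup>2 \<le> rare_prob j z t"
    and "real t + d \<le> real n * s \<Longrightarrow> rare_prob j z t \<le> g + real n * s / d\<^sup>2"
proof -
  define P where "P = poisson_pmf (real n * s)"
  define B where "B = {r. d \<le> \<bar>real r - real n * s\<bar>}"
  have B: "measure_pmf.prob P B \<le> real n * s / d\<^sup>2"
    unfolding P_def B_def using n s d by (intro poisson_deviation) auto
  have g: "g = measure_pmf.expectation P (rare_prob j z)"
    unfolding g_def P_def using n s by (simp add: expectation_rare_prob)
  have int: "integrable (measure_pmf P) (rare_prob j z)"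
    by (rule measure_pmf.integrable_const_bound[where B = 1]) (auto simp: rare_prob_bounds)
  have ind: "integrable (measure_pmf P) (indicator B :: nat \<Rightarrow> real)"
    by (rule measure_pmf.integrable_const_bound[where B = 1]) (auto simp: indicator_def)
  {
    assume t: "real n * s + d \<le> real t"
    have "rare_prob j z r \<le> rare_prob j z t + indicator B r" for r
    proof (cases "r \<in> B")
      case True
      then show ?thesis
        using rare_prob_bounds[of j z r] rare_prob_bounds[of j z t] by simp
    next
      case False
      then show ?thesis
        using t by (auto simp: B_def intro!: rare_prob_mono)
    qed
    then have "g \<le> measure_pmf.expectation P (\<lambda>r. rare_prob j z t + indicator B r)"
      unfolding g by (intro integral_mono int) (auto intro!: ind)
    also have "\<dots> = rare_prob j z t + measure_pmf.prob P B"
      using ind by (subst Bochner_Integration.integral_add) auto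
    finally show "g - real n * s / d\<^sup>2 \<le> rare_prob j z t"
      using B by simp
  }
  {
    assume t: "real t + d \<le> real n * s"
    have "rare_prob j z t - indicator B r \<le> rare_prob j z r" for r
    proof (cases "r \<in> B")
      case True
      then show ?thesis
        using rare_prob_bounds[of j z r] rare_prob_bounds[of j z t] by simp
    next
      case False
      then show ?thesis
        using t by (auto simp: B_def intro!: rare_prob_mono)
    qed
    then have "measure_pmf.expectation P (\<lambda>r. rare_prob j z t - indicator B r) \<le> g"
      unfolding g by (intro integral_mono int) (auto intro!: ind)
    also have "measure_pmf.expectation P (\<lambda>r. rare_prob j z t - indicator B r) =
        rare_prob j z t - measure_pmf.prob P B"
      using ind by (subst Bochner_Integration.integral_diff) auto
    finally show "rare_prob j z t \<le> g + real n * s / d\<^sup>2"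
      using B by simp
  }
qed

end

section \<open>The critical time scale\<close>

text \<open>The time \<open>s\<close> (number of draws per type) at which the expected number of incomplete types, about
  \<open>n exp (- s) s ^ (m - 1) / (m - 1)!\<close>, is close to \<open>l\<close>. Changing \<open>l\<close> only shifts it by a constant.\<close>

definition critical_time :: "nat \<Rightarrow> real \<Rightarrow> nat \<Rightarrow> real" where
  "critical_time m l n = ln (real n) + real (m - 1) * ln (ln (real n)) - ln (fact (m - 1) * l)"

text \<open>The normalizing factor \<open>k! / (ln n) ^ (k - m + 1)\<close> of the theorem, written with two separate powers so
  that it also makes sense for \<open>k = m - 1\<close>.\<close>

definition ton_scale :: "nat \<Rightarrow> nat \<Rightarrow> nat \<Rightarrow> real" where
  "ton_scale m k n = fact k * ln (real n) ^ (m - 1) / ln (real n) ^ k"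

lemma eventually_ln_nat_gt: "eventually (\<lambda>n. c < ln (real n)) sequentially"
proof -
  have "filterlim (\<lambda>n. ln (real n)) at_top sequentially"
    by (rule filterlim_compose[OF ln_at_top filterlim_real_sequentially])
  then show ?thesis
    by (simp add: filterlim_at_top_dense)
qed

lemma critical_time_asymp: "(\<lambda>n. critical_time m l n / ln (real n)) \<longlonglongrightarrow> 1"
proof -
  define c where "c = ln (fact (m - 1) * l)"
  have "(\<lambda>n. 1 + real (m - 1) * (ln (ln (real n)) / ln (real n)) - c * (1 / ln (real n)))
      \<longlonglongrightarrow> 1 + real (m - 1) * 0 - c * 0"
    by (intro tendsto_intros; real_asymp)
  moreover have "eventually (\<lambda>n. 1 + real (m - 1) * (ln (ln (real n)) / ln (real n)) - c * (1 / ln (real n)) =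
      critical_time m l n / ln (real n)) sequentially"
    using eventually_ln_nat_gt[of 0]
    by eventually_elim (simp add: critical_time_def c_def field_simps)
  ultimately show ?thesis
    by (simp add: tendsto_cong)
qed

lemma eventually_critical_time_pos: "eventually (\<lambda>n. 0 < critical_time m l n) sequentially"
proof -
  have "eventually (\<lambda>n. 0 < critical_time m l n / ln (real n)) sequentially"
    by (rule order_tendstoD(1)[OF critical_time_asymp]) simp
  then show ?thesis
    using eventually_ln_nat_gt[of 0] by eventually_elim (simp add: zero_less_divide_iff)
qed

lemma exp_critical_time:
  assumes "0 < l" "0 < ln (real n)"
  shows "real n * exp (- critical_time m l n) = fact (m - 1) * l / ln (real n) ^ (m - 1)"
proof -
  have "0 < real n"
    using assms(2) by (cases "n = 0") auto
  moreover have "exp (real (m - 1) * ln (ln (real n))) = ln (real n) ^ (m - 1)"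
    using assms(2) by (simp add: exp_of_nat_mult)
  ultimately show ?thesis
    using assms by (simp add: critical_time_def exp_diff exp_add exp_minus field_simps)
qed

lemma poisson_cdf_eq:
  assumes "0 < s"
  shows "poisson_cdf s j = exp (- s) * (\<Sum>i\<le>j. s ^ i / fact i)"
  using assms by (simp add: poisson_cdf_def measure_measure_pmf_finite sum_distrib_left mult.commute)

text \<open>For \<open>j\<close> small compared with \<open>s\<close> the partial sum is dominated by its last term; the factor
  \<open>s / (s - j)\<close> is the sum of the geometric series with ratio \<open>j / s\<close>, which bounds the ratio of
  neighbouring terms.\<close>

lemma exp_partial_sum_le:
  fixes s :: real
  assumes "real j < s"
  shows "(\<Sum>i\<le>j. s ^ i / fact i) \<le> s ^ j / fact j * (s / (s - real j))"
  using assms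
proof (induction j)
  case 0
  then show ?case by simp
next
  case (Suc j)
  have pos: "0 < s - real j" "0 < s - real (Suc j)" "0 < s"
    using Suc.prems by auto
  have "(\<Sum>i\<le>Suc j. s ^ i / fact i) \<le> s ^ Suc j / fact (Suc j) + s ^ j / fact j * (s / (s - real j))"
    using Suc by simp
  also have "s ^ j / fact j * (s / (s - real j)) =
      s ^ Suc j / fact (Suc j) * (real (Suc j) / (s - real j))"
    by (simp add: divide_simps)
  also have "s ^ Suc j / fact (Suc j) + \<dots> = s ^ Suc j / fact (Suc j) * ((s + 1) / (s - real j))"
  proof -
    have "(s + 1) / (s - real j) = 1 + real (Suc j) / (s - real j)"
      using pos by (simp add: divide_simps)
    then show ?thesis
      by (simp only: distrib_left mult_1_right)
  qed
  also have "\<dots> \<le> s ^ Suc j / fact (Suc j) * (s / (s - real (Suc j)))"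
  proof (rule mult_left_mono)
    have "(s + 1) * (s - real (Suc j)) \<le> s * (s - real j)"
      by (simp add: algebra_simps)
    then show "(s + 1) / (s - real j) \<le> s / (s - real (Suc j))"
      using pos by (simp add: divide_le_eq le_divide_eq mult.commute pos_divide_le_eq pos_le_divide_eq)
    show "0 \<le> s ^ Suc j / fact (Suc j)"
      using pos by simp
  qed
  finally show ?case .
qed

text \<open>This is where the growth conditions on \<open>k\<close> enter: \<open>critical_time\<close> exceeds \<open>ln n\<close> by
  \<open>(m - 1) ln (ln n) + O(1)\<close>, so \<open>k\<close> times the relative excess tends to 0 under these conditions,
  and \<open>1 - 1 / x \<le> ln x \<le> x - 1\<close> turns this into a statement about the power.\<close>

lemma power_critical_time_ratio:
  fixes k :: "nat \<Rightarrow> nat"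
  assumes k1: "(\<lambda>n. real (k n) / ln (real n)) \<longlonglongrightarrow> 0"
    and k2: "(\<lambda>n. real (m - 1) * (real (k n) * ln (ln (real n)) / ln (real n))) \<longlonglongrightarrow> 0"
  shows "(\<lambda>n. (critical_time m l n / ln (real n)) ^ k n) \<longlonglongrightarrow> 1"
proof -
  define x where "x n = critical_time m l n / ln (real n)" for n
  define c where "c = ln (fact (m - 1) * l)"
  have x: "x \<longlonglongrightarrow> 1"
    unfolding x_def[abs_def] by (rule critical_time_asymp)
  have "(\<lambda>n. real (m - 1) * (real (k n) * ln (ln (real n)) / ln (real n)) - c * (real (k n) / ln (real n)))
      \<longlonglongrightarrow> 0 - c * 0"
    by (intro tendsto_intros k1 k2)
  moreover have "eventually (\<lambda>n. real (m - 1) * (real (k n) * ln (ln (real n)) / ln (real n))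
      - c * (real (k n) / ln (real n)) = real (k n) * (x n - 1)) sequentially"
    using eventually_ln_nat_gt[of 0]
    by eventually_elim (simp add: critical_time_def x_def c_def field_simps)
  ultimately have up: "(\<lambda>n. real (k n) * (x n - 1)) \<longlonglongrightarrow> 0"
    by (simp add: tendsto_cong)
  have "(\<lambda>n. real (k n) * (x n - 1) * inverse (x n)) \<longlonglongrightarrow> 0 * inverse 1"
    by (intro tendsto_intros up x) simp
  then have low: "(\<lambda>n. real (k n) * (x n - 1) * inverse (x n)) \<longlonglongrightarrow> 0"
    by simp
  have x_pos: "eventually (\<lambda>n. 0 < x n) sequentially"
    by (rule order_tendstoD(1)[OF x]) simp
  have "(\<lambda>n. real (k n) * ln (x n)) \<longlonglongrightarrow> 0"
  proof (rule tendsto_sandwich[OF _ _ low up])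
    show "eventually (\<lambda>n. real (k n) * (x n - 1) * inverse (x n) \<le> real (k n) * ln (x n)) sequentially"
      using x_pos
    proof eventually_elim
      case (elim n)
      have "1 - inverse (x n) \<le> ln (x n)"
        using ln_le_minus_one[of "inverse (x n)"] elim by (simp add: ln_inverse)
      moreover have "(x n - 1) * inverse (x n) = 1 - inverse (x n)"
        using elim by (simp add: field_simps)
      ultimately show ?case
        by (simp add: mult.assoc mult_left_mono)
    qed
    show "eventually (\<lambda>n. real (k n) * ln (x n) \<le> real (k n) * (x n - 1)) sequentially"
      using x_pos by eventually_elim (simp add: ln_le_minus_one mult_left_mono)
  qed
  then have "(\<lambda>n. exp (real (k n) * ln (x n))) \<longlonglongrightarrow> exp 0"
    by (rule tendsto_exp)
  moreover have "eventually (\<lambda>n. exp (real (k n) * ln (x n)) = x n ^ k n) sequentially"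
    using x_pos by eventually_elim (simp add: exp_of_nat_mult)
  ultimately show ?thesis
    by (simp add: tendsto_cong x_def)
qed

text \<open>The Poisson distribution function at \<open>k\<close> is asymptotic to its last term \<open>exp (- s) s ^ k / k!\<close>.
  Inserting the value of \<open>exp (- s)\<close> leaves \<open>(m - 1)! l\<close> times the \<open>k\<close>-th power of \<open>s / ln n\<close>, which tends
  to 1.\<close>

lemma scaled_mean_rare_types:
  fixes k :: "nat \<Rightarrow> nat"
  assumes l: "0 < l"
    and k1: "(\<lambda>n. real (k n) / ln (real n)) \<longlonglongrightarrow> 0"
    and k2: "(\<lambda>n. real (m - 1) * (real (k n) * ln (ln (real n)) / ln (real n))) \<longlonglongrightarrow> 0"
  shows "(\<lambda>n. ton_scale m (k n) n * (real n * poisson_cdf (critical_time m l n) (k n)))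
    \<longlonglongrightarrow> fact (m - 1) * l"
proof -
  define s where "s = critical_time m l"
  define R where "R n = fact (k n) / s n ^ k n * (\<Sum>i\<le>k n. s n ^ i / fact i)" for n
  have s_pos: "eventually (\<lambda>n. 0 < s n) sequentially"
    unfolding s_def by (rule eventually_critical_time_pos)
  have ratio: "(\<lambda>n. s n / ln (real n)) \<longlonglongrightarrow> 1"
    unfolding s_def by (rule critical_time_asymp)
  have "(\<lambda>n. real (k n) / ln (real n) / (s n / ln (real n))) \<longlonglongrightarrow> 0 / 1"
    by (intro tendsto_intros k1 ratio) simp
  moreover have "eventually (\<lambda>n. real (k n) / ln (real n) / (s n / ln (real n)) = real (k n) / s n) sequentially"
    using eventually_ln_nat_gt[of 0] by eventually_elim simp
  ultimately have ks: "(\<lambda>n. real (k n) / s n) \<longlonglongrightarrow> 0"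
    unfolding div_0 by (rule Lim_transform_eventually)
  have k_lt: "eventually (\<lambda>n. real (k n) < s n) sequentially"
    using order_tendstoD(2)[OF ks zero_less_one] s_pos by eventually_elim simp
  have "R \<longlonglongrightarrow> 1"
  proof (rule tendsto_sandwich)
    show "(\<lambda>n. 1) \<longlonglongrightarrow> (1 :: real)"
      by simp
    have "(\<lambda>n. 1 / (1 - real (k n) / s n)) \<longlonglongrightarrow> 1 / (1 - 0)"
      by (intro tendsto_intros ks) simp
    then show "(\<lambda>n. 1 / (1 - real (k n) / s n)) \<longlonglongrightarrow> 1"
      by simp
    show "eventually (\<lambda>n. 1 \<le> R n) sequentially"
      using s_pos
    proof eventually_elim
      case (elim n)
      have "s n ^ k n / fact (k n) \<le> (\<Sum>i\<le>k n. s n ^ i / fact i)"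
        by (rule member_le_sum) (use elim in auto)
      then have "fact (k n) / s n ^ k n * (s n ^ k n / fact (k n)) \<le> R n"
        unfolding R_def by (rule mult_left_mono) (use elim in simp)
      then show ?case
        using elim by simp
    qed
    show "eventually (\<lambda>n. R n \<le> 1 / (1 - real (k n) / s n)) sequentially"
      using s_pos k_lt
    proof eventually_elim
      case (elim n)
      have "R n \<le> fact (k n) / s n ^ k n * (s n ^ k n / fact (k n) * (s n / (s n - real (k n))))"
        unfolding R_def by (rule mult_left_mono[OF exp_partial_sum_le]) (use elim in simp_all)
      also have "\<dots> = s n / (s n - real (k n))"
        using elim by simp
      also have "\<dots> = 1 / (1 - real (k n) / s n)"
        using elim by (simp add: field_simps)
      finally show ?case .
    qed
  qed
  then have "(\<lambda>n. fact (m - 1) * l * R n * (s n / ln (real n)) ^ k n) \<longlonglongrightarrow> fact (m - 1) * l * 1 * 1"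
    unfolding s_def by (intro tendsto_intros power_critical_time_ratio k1 k2)
  moreover have "eventually (\<lambda>n. fact (m - 1) * l * R n * (s n / ln (real n)) ^ k n =
      ton_scale m (k n) n * (real n * poisson_cdf (s n) (k n))) sequentially"
    using s_pos eventually_ln_nat_gt[of 0]
  proof eventually_elim
    case (elim n)
    have "ton_scale m (k n) n * (real n * poisson_cdf (s n) (k n)) =
        ton_scale m (k n) n * (real n * exp (- s n)) * (\<Sum>i\<le>k n. s n ^ i / fact i)"
      using elim by (simp add: poisson_cdf_eq)
    also have "\<dots> = ton_scale m (k n) n * (fact (m - 1) * l / ln (real n) ^ (m - 1)) *
        (\<Sum>i\<le>k n. s n ^ i / fact i)"
      using elim l by (simp add: s_def exp_critical_time)
    also have "\<dots> = fact (m - 1) * l * R n * (s n / ln (real n)) ^ k n"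
      using elim by (simp add: R_def ton_scale_def power_divide)
    finally show ?case
      by simp
  qed
  ultimately show ?thesis
    by (simp add: tendsto_cong s_def)
qed

text \<open>Lowering the threshold from \<open>k\<close> to \<open>k - 1\<close> costs a factor of order \<open>k / ln n\<close> in the mean.\<close>

lemma scaled_mean_rarer_types:
  fixes k :: "nat \<Rightarrow> nat"
  assumes l: "0 < l" and k0: "eventually (\<lambda>n. 1 \<le> k n) sequentially"
    and k1: "(\<lambda>n. real (k n) / ln (real n)) \<longlonglongrightarrow> 0"
    and k2: "(\<lambda>n. real (m - 1) * (real (k n) * ln (ln (real n)) / ln (real n))) \<longlonglongrightarrow> 0"
  shows "(\<lambda>n. ton_scale m (k n) n * (real n * poisson_cdf (critical_time m l n) (k n - 1)))
    \<longlonglongrightarrow> 0"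
proof -
  have k1': "(\<lambda>n. real (k n - 1) / ln (real n)) \<longlonglongrightarrow> 0"
  proof (rule Lim_null_comparison[OF _ k1])
    show "eventually (\<lambda>n. norm (real (k n - 1) / ln (real n)) \<le> real (k n) / ln (real n)) sequentially"
      using eventually_ln_nat_gt[of 0] by eventually_elim (simp add: divide_right_mono)
  qed
  have k2': "(\<lambda>n. real (m - 1) * (real (k n - 1) * ln (ln (real n)) / ln (real n))) \<longlonglongrightarrow> 0"
  proof (rule Lim_null_comparison[OF _ k2])
    show "eventually (\<lambda>n. norm (real (m - 1) * (real (k n - 1) * ln (ln (real n)) / ln (real n)))
        \<le> real (m - 1) * (real (k n) * ln (ln (real n)) / ln (real n))) sequentially"
      using eventually_ln_nat_gt[of 1]
    proof eventually_elim
      case (elim n)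
      then have "0 < ln (ln (real n))"
        by simp
      with elim show ?case
        by (simp add: abs_mult mult_left_mono mult_right_mono divide_right_mono)
    qed
  qed
  have "(\<lambda>n. real (k n) / ln (real n) *
      (ton_scale m (k n - 1) n * (real n * poisson_cdf (critical_time m l n) (k n - 1))))
      \<longlonglongrightarrow> 0 * (fact (m - 1) * l)"
    by (intro tendsto_mult k1 scaled_mean_rare_types[OF l k1' k2'])
  moreover have "eventually (\<lambda>n. real (k n) / ln (real n) *
      (ton_scale m (k n - 1) n * (real n * poisson_cdf (critical_time m l n) (k n - 1))) =
      ton_scale m (k n) n * (real n * poisson_cdf (critical_time m l n) (k n - 1))) sequentially"
    using k0 eventually_ln_nat_gt[of 0]
  proof eventually_elim
    case (elim n)
    then obtain j where "k n = Suc j"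
      by (cases "k n") auto
    then show ?case
      by (simp add: ton_scale_def)
  qed
  ultimately show ?thesis
    by (simp add: tendsto_cong)
qed

lemma fact_over_power_antimono:
  fixes x :: real
  assumes "m \<le> k" "real k \<le> x" "0 < x"
  shows "fact k / x ^ k \<le> fact m / x ^ m"
  using assms
proof (induction k rule: dec_induct)
  case (step k)
  have "fact (Suc k) / x ^ Suc k = fact k / x ^ k * (real (Suc k) / x)"
    by (simp add: mult.commute)
  also have "\<dots> \<le> fact k / x ^ k"
    using step by (intro mult_left_le) auto
  also have "\<dots> \<le> fact m / x ^ m"
    using step by auto
  finally show ?case .
qed simp

text \<open>While \<open>k \<le> ln n\<close>, the quotient \<open>k! / (ln n) ^ k\<close> decreases in \<open>k\<close>, so the scale is at most its value
  \<open>m! / ln n\<close> at \<open>k = m\<close>. Hence the mean number of types with at most \<open>k\<close> copies tends to infinity.\<close>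

lemma ton_scale_tendsto_0:
  assumes m: "1 \<le> m" and k0: "eventually (\<lambda>n. m \<le> k n) sequentially"
    and k1: "(\<lambda>n. real (k n) / ln (real n)) \<longlonglongrightarrow> 0"
  shows "(\<lambda>n. ton_scale m (k n) n) \<longlonglongrightarrow> 0"
proof (rule Lim_null_comparison)
  have "(\<lambda>n. fact m * (1 / ln (real n))) \<longlonglongrightarrow> fact m * 0"
    by (intro tendsto_intros; real_asymp)
  then show "(\<lambda>n. fact m / ln (real n)) \<longlonglongrightarrow> 0"
    by simp
  show "eventually (\<lambda>n. norm (ton_scale m (k n) n) \<le> fact m / ln (real n)) sequentially"
    using k0 eventually_ln_nat_gt[of 0] order_tendstoD(2)[OF k1 zero_less_one]
  proof eventually_elim
    case (elim n)
    have "fact (k n) / ln (real n) ^ k n * ln (real n) ^ (m - 1) \<le>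
        fact m / ln (real n) ^ m * ln (real n) ^ (m - 1)"
      using elim by (intro mult_right_mono fact_over_power_antimono) auto
    also have "\<dots> = fact m / ln (real n)"
      using m elim by (cases m) auto
    finally show ?case
      using elim by (simp add: ton_scale_def)
  qed
qed

section \<open>Limits of binomial probabilities\<close>

text \<open>A binomial variable has variance at most its mean \<open>n p\<close>, so the variance of its product with \<open>v\<close> is at most
  \<open>v (v n p)\<close>, which tends to 0. Hence the product concentrates at \<open>c\<close>, also when \<open>c = 0\<close>.\<close>

lemma binomial_below_mean:
  fixes y :: real
  assumes p: "\<And>n. p n \<in> {0..1}" and v0: "eventually (\<lambda>n. 0 < v n) sequentially"
    and v: "v \<longlonglongrightarrow> 0" and mean: "(\<lambda>n. v n * (real n * p n)) \<longlonglongrightarrow> c" and y: "y < c"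
  shows "(\<lambda>n. measure_pmf.prob (binomial_pmf n (p n)) {r. real r \<le> y / v n}) \<longlonglongrightarrow> 0"
proof (rule Lim_null_comparison)
  define d where "d = (c - y) / 2"
  have d: "0 < d"
    using y by (simp add: d_def)
  have "(\<lambda>n. v n * (v n * (real n * p n)) / d\<^sup>2) \<longlonglongrightarrow> 0 * c / d\<^sup>2"
    by (intro tendsto_intros v mean) (use d in simp)
  then show "(\<lambda>n. v n * (v n * (real n * p n)) / d\<^sup>2) \<longlonglongrightarrow> 0"
    by simp
  have "eventually (\<lambda>n. y + d < v n * (real n * p n)) sequentially"
    by (rule order_tendstoD(1)[OF mean]) (use y in \<open>simp add: d_def field_simps\<close>)
  then show "eventually (\<lambda>n. norm (measure_pmf.prob (binomial_pmf n (p n)) {r. real r \<le> y / v n})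
      \<le> v n * (v n * (real n * p n)) / d\<^sup>2) sequentially"
    using v0
  proof eventually_elim
    case (elim n)
    have "{r. real r \<le> y / v n} \<subseteq> {r. d / v n \<le> \<bar>real r - real n * p n\<bar>}"
    proof safe
      fix r assume "real r \<le> y / v n"
      moreover have "(y + d) / v n \<le> real n * p n"
        using elim by (simp add: field_simps)
      ultimately show "d / v n \<le> \<bar>real r - real n * p n\<bar>"
        by (simp add: add_divide_distrib)
    qed
    then have "measure_pmf.prob (binomial_pmf n (p n)) {r. real r \<le> y / v n} \<le>
        measure_pmf.prob (binomial_pmf n (p n)) {r. d / v n \<le> \<bar>real r - real n * p n\<bar>}"
      by (intro measure_pmf.finite_measure_mono) auto
    also have "\<dots> \<le> real n * p n / (d / v n)\<^sup>2"
      by (rule binomial_deviation[OF p]) (use d elim in simp)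
    finally show ?case
      by (simp add: power2_eq_square field_simps)
  qed
qed

lemma binomial_above_mean:
  fixes y :: real
  assumes p: "\<And>n. p n \<in> {0..1}" and v0: "eventually (\<lambda>n. 0 < v n) sequentially"
    and v: "v \<longlonglongrightarrow> 0" and mean: "(\<lambda>n. v n * (real n * p n)) \<longlonglongrightarrow> c" and y: "c < y"
  shows "(\<lambda>n. measure_pmf.prob (binomial_pmf n (p n)) {r. real r \<le> y / v n}) \<longlonglongrightarrow> 1"
proof (rule tendsto_sandwich)
  define d where "d = (y - c) / 2"
  have d: "0 < d"
    using y by (simp add: d_def)
  have "(\<lambda>n. 1 - v n * (v n * (real n * p n)) / d\<^sup>2) \<longlonglongrightarrow> 1 - 0 * c / d\<^sup>2"
    by (intro tendsto_intros v mean) (use d in simp)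
  then show "(\<lambda>n. 1 - v n * (v n * (real n * p n)) / d\<^sup>2) \<longlonglongrightarrow> 1"
    by simp
  show "(\<lambda>n. 1) \<longlonglongrightarrow> (1 :: real)"
    by simp
  show "eventually (\<lambda>n. measure_pmf.prob (binomial_pmf n (p n)) {r. real r \<le> y / v n} \<le> 1) sequentially"
    by simp
  have "eventually (\<lambda>n. v n * (real n * p n) < y - d) sequentially"
    by (rule order_tendstoD(2)[OF mean]) (use y in \<open>simp add: d_def field_simps\<close>)
  then show "eventually (\<lambda>n. 1 - v n * (v n * (real n * p n)) / d\<^sup>2
      \<le> measure_pmf.prob (binomial_pmf n (p n)) {r. real r \<le> y / v n}) sequentially"
    using v0
  proof eventually_elim
    case (elim n)
    have "- {r. real r \<le> y / v n} \<subseteq> {r. d / v n \<le> \<bar>real r - real n * p n\<bar>}"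
    proof safe
      fix r assume "\<not> real r \<le> y / v n"
      moreover have "real n * p n \<le> (y - d) / v n"
        using elim by (simp add: field_simps)
      ultimately show "d / v n \<le> \<bar>real r - real n * p n\<bar>"
        by (simp add: diff_divide_distrib)
    qed
    then have "measure_pmf.prob (binomial_pmf n (p n)) (- {r. real r \<le> y / v n}) \<le>
        measure_pmf.prob (binomial_pmf n (p n)) {r. d / v n \<le> \<bar>real r - real n * p n\<bar>}"
      by (intro measure_pmf.finite_measure_mono) auto
    also have "\<dots> \<le> real n * p n / (d / v n)\<^sup>2"
      by (rule binomial_deviation[OF p]) (use d elim in simp)
    also have "\<dots> = v n * (v n * (real n * p n)) / d\<^sup>2"
      by (simp add: power2_eq_square field_simps)
    finally show ?case
      using measure_pmf.prob_compl[of "{r. real r \<le> y / v n}" "binomial_pmf n (p n)"]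
      by (simp add: Compl_eq_Diff_UNIV)
  qed
qed

text \<open>The Poisson limit at 0, obtained from \<open>exp (- p / (1 - p)) \<le> 1 - p \<le> exp (- p)\<close>.\<close>

lemma binomial_zero_limit:
  assumes p: "\<And>n. p n \<in> {0..1}" and mean: "(\<lambda>n. real n * p n) \<longlonglongrightarrow> l"
  shows "(\<lambda>n. measure_pmf.prob (binomial_pmf n (p n)) {r. real r \<le> 0}) \<longlonglongrightarrow> exp (- l)"
proof -
  have "(\<lambda>n. real n * p n * (1 / real n)) \<longlonglongrightarrow> l * 0"
    by (intro tendsto_mult mean) real_asymp
  moreover have "eventually (\<lambda>n. real n * p n * (1 / real n) = p n) sequentially"
    using eventually_gt_at_top[of 0] by eventually_elim simp
  ultimately have p0: "p \<longlonglongrightarrow> 0"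
    unfolding mult_zero_right by (rule Lim_transform_eventually)
  have "(\<lambda>n. (1 - p n) ^ n) \<longlonglongrightarrow> exp (- l)"
  proof (rule tendsto_sandwich)
    have "(\<lambda>n. exp (- (real n * p n / (1 - p n)))) \<longlonglongrightarrow> exp (- (l / (1 - 0)))"
      by (intro tendsto_intros mean p0) simp
    then show "(\<lambda>n. exp (- (real n * p n / (1 - p n)))) \<longlonglongrightarrow> exp (- l)"
      by simp
    show "(\<lambda>n. exp (- (real n * p n))) \<longlonglongrightarrow> exp (- l)"
      by (intro tendsto_intros mean)
    show "eventually (\<lambda>n. (1 - p n) ^ n \<le> exp (- (real n * p n))) sequentially"
    proof (intro always_eventually allI)
      fix n
      have "(1 - p n) ^ n \<le> exp (- p n) ^ n"
        using p[of n] exp_ge_add_one_self[of "- p n"] by (intro power_mono) auto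
      then show "(1 - p n) ^ n \<le> exp (- (real n * p n))"
        by (simp flip: exp_of_nat_mult)
    qed
    show "eventually (\<lambda>n. exp (- (real n * p n / (1 - p n))) \<le> (1 - p n) ^ n) sequentially"
      using order_tendstoD(2)[OF p0 zero_less_one]
    proof eventually_elim
      case (elim n)
      have "1 / (1 - p n) \<le> exp (p n / (1 - p n))"
        using exp_ge_add_one_self[of "p n / (1 - p n)"] elim by (simp add: field_simps)
      then have "exp (- (p n / (1 - p n))) \<le> 1 - p n"
        using elim by (simp add: exp_minus field_simps)
      then have "exp (- (p n / (1 - p n))) ^ n \<le> (1 - p n) ^ n"
        by (intro power_mono) auto
      then show ?case
        by (simp flip: exp_of_nat_mult)
    qed
  qed
  moreover have "measure_pmf.prob (binomial_pmf n (p n)) {r. real r \<le> 0} = (1 - p n) ^ n" for n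
    using p[of n] by (simp add: measure_pmf_single)
  ultimately show ?thesis
    by simp
qed

section \<open>De-Poissonization in the critical window\<close>

definition critical_draws :: "nat \<Rightarrow> real \<Rightarrow> nat \<Rightarrow> nat" where
  "critical_draws m l n = nat \<lfloor>real n * critical_time m l n\<rfloor>"

locale coupon_collectors =
  fixes M :: "nat \<Rightarrow> 'a measure" and C :: "nat \<Rightarrow> nat \<Rightarrow> 'a \<Rightarrow> nat"
  assumes coupons: "\<And>n. n \<ge> 1 \<Longrightarrow> coupon_collector (M n) n (C n)"
begin

abbreviation "rare n \<equiv> coupon_collector.rare_prob (M n) n (C n)"

text \<open>Up to rounding, the mean \<open>n * critical_time m l' n\<close> differs from \<open>critical_draws m l n\<close> by a constant
  multiple of \<open>n\<close>, whereas a Poisson variable with this mean fluctuates only on the scale \<open>sqrt (n ln n)\<close>.\<close>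

lemma critical_draws_deviation:
  assumes l: "0 < l" "0 < l'" "l \<noteq> l'"
  defines "d \<equiv> (\<lambda>n. real n * \<bar>ln l - ln l'\<bar> / 2)"
  shows "(\<lambda>n. real n * critical_time m l' n / (d n)\<^sup>2) \<longlonglongrightarrow> 0"
    and "l < l' \<Longrightarrow> eventually (\<lambda>n. real n * critical_time m l' n + d n \<le> real (critical_draws m l n)) sequentially"
    and "l' < l \<Longrightarrow> eventually (\<lambda>n. real (critical_draws m l n) + d n \<le> real n * critical_time m l' n) sequentially"
proof -
  define c where "c = \<bar>ln l - ln l'\<bar> / 2"
  have c: "0 < c"
    using l by (simp add: c_def)
  have "(\<lambda>n. critical_time m l' n / ln (real n) * (ln (real n) / real n) / c\<^sup>2) \<longlonglongrightarrow> 1 * 0 / c\<^sup>2"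
    by (intro tendsto_intros critical_time_asymp; (use c in simp | real_asymp))
  moreover have "eventually (\<lambda>n. critical_time m l' n / ln (real n) * (ln (real n) / real n) / c\<^sup>2 =
      real n * critical_time m l' n / (d n)\<^sup>2) sequentially"
    using eventually_ln_nat_gt[of 0] eventually_gt_at_top[of 0]
    by eventually_elim (simp add: d_def c_def power2_eq_square)
  ultimately show "(\<lambda>n. real n * critical_time m l' n / (d n)\<^sup>2) \<longlonglongrightarrow> 0"
    by (simp add: tendsto_cong)
  have diff: "critical_time m l n - critical_time m l' n = ln l' - ln l" for n
    using l by (simp add: critical_time_def ln_mult)
  have big: "eventually (\<lambda>n. 1 \<le> real n * c) sequentially"
    using c by real_asymp
  show "eventually (\<lambda>n. real n * critical_time m l' n + d n \<le> real (critical_draws m l n)) sequentially"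
    if "l < l'"
    using big eventually_critical_time_pos[of m l]
  proof eventually_elim
    case (elim n)
    have "ln l < ln l'"
      using l that by simp
    then have "critical_time m l n = critical_time m l' n + 2 * c"
      using diff[of n] by (simp add: c_def field_simps)
    then have "real n * critical_time m l n = real n * critical_time m l' n + d n + real n * c"
      by (simp add: d_def c_def algebra_simps)
    moreover have "real n * critical_time m l n - 1 \<le> real (critical_draws m l n)"
      using elim unfolding critical_draws_def by linarith
    ultimately show ?case
      using elim by linarith
  qed
  show "eventually (\<lambda>n. real (critical_draws m l n) + d n \<le> real n * critical_time m l' n) sequentially"
    if "l' < l"
    using eventually_critical_time_pos[of m l]
  proof eventually_elim
    case (elim n)
    have "ln l' < ln l"
      using l that by simp
    then have "critical_time m l' n = critical_time m l n + 2 * c"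
      using diff[of n] by (simp add: c_def field_simps)
    then have "real n * critical_time m l' n = real n * critical_time m l n + d n + real n * c"
      by (simp add: d_def c_def algebra_simps)
    moreover have "0 \<le> real n * critical_time m l n"
      using elim by simp
    then have "real (critical_draws m l n) \<le> real n * critical_time m l n"
      unfolding critical_draws_def by linarith
    moreover have "0 \<le> real n * c"
      using c by simp
    ultimately show ?case
      by linarith
  qed
qed

text \<open>Limits of Poissonized probabilities transfer to a fixed number of draws: \<open>rare_prob\<close> at parameter \<open>l\<close> is
  compared with the Poissonized probabilities at parameters \<open>l'\<close> slightly above and slightly below \<open>l\<close>, and
  continuity of the limit in \<open>l\<close> closes the gap.\<close>

lemma rare_prob_limit:
  fixes G :: "real \<Rightarrow> real"
  assumes l: "0 < l"
    and G: "eventually (\<lambda>l'. (\<lambda>n. measure_pmf.prob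
        (binomial_pmf n (poisson_cdf (critical_time m l' n) (j n))) {r. real r \<le> z n}) \<longlonglongrightarrow> G l') (at l)"
    and cont: "isCont G l"
  shows "(\<lambda>n. rare n (j n) (z n) (critical_draws m l n)) \<longlonglongrightarrow> G l"
proof -
  define g where "g l' n = measure_pmf.prob
    (binomial_pmf n (poisson_cdf (critical_time m l' n) (j n))) {r. real r \<le> z n}" for l' n
  define err where "err l' n = real n * critical_time m l' n / (real n * \<bar>ln l - ln l'\<bar> / 2)\<^sup>2" for l' n
  have G_near: "eventually (\<lambda>l'. g l' \<longlonglongrightarrow> G l') (at l)"
    using G by (simp add: g_def[abs_def])
  have G_cont: "(G \<longlongrightarrow> G l) (at l)"
    using cont by (simp add: isCont_def)
  have pos: "eventually (\<lambda>l'. 0 < l') (at l)"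
    using order_tendstoD(1)[OF tendsto_ident_at l] .
  note good = eventually_conj[OF G_near pos]
  show ?thesis
  proof (rule order_tendstoI)
    fix a assume "a < G l"
    have "eventually (\<lambda>l'. l < l' \<and> (g l' \<longlonglongrightarrow> G l') \<and> 0 < l' \<and> a < G l') (at_right l)"
      using eventually_at_right_less[of l] filter_leD[OF at_le[of "{l<..}" UNIV l] good, simplified]
        filter_leD[OF at_le[of "{l<..}" UNIV l] order_tendstoD(1)[OF G_cont \<open>a < G l\<close>], simplified]
      by eventually_elim auto
    then obtain l' where l': "l < l'" "g l' \<longlonglongrightarrow> G l'" "0 < l'" "a < G l'"
      using eventually_happens'[OF trivial_limit_at_right_real] by blast
    note dev = critical_draws_deviation[OF l l'(3), of m, folded err_def]
    have "(\<lambda>n. g l' n - err l' n) \<longlonglongrightarrow> G l' - 0"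
      using l' by (intro tendsto_diff dev) auto
    then have "eventually (\<lambda>n. a < g l' n - err l' n) sequentially"
      using l' by (intro order_tendstoD(1)) auto
    then show "eventually (\<lambda>n. a < rare n (j n) (z n) (critical_draws m l n)) sequentially"
      using dev(2)[OF less_imp_neq[OF l'(1)] l'(1)] eventually_critical_time_pos[of m l'] eventually_gt_at_top[of 0]
    proof eventually_elim
      case (elim n)
      interpret coupon_collector "M n" n "C n"
        by (rule coupons) (use elim in simp)
      have "g l' n - err l' n \<le> rare_prob (j n) (z n) (critical_draws m l n)"
        unfolding g_def err_def using elim l l' by (intro rare_prob_depoissonization(1)) auto
      then show ?case
        using elim by linarith
    qed
  next
    fix a assume "G l < a"
    have "eventually (\<lambda>l'. l' < l) (at_left l)"
      by (simp add: eventually_at_filter)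
    then have "eventually (\<lambda>l'. l' < l \<and> (g l' \<longlonglongrightarrow> G l') \<and> 0 < l' \<and> G l' < a) (at_left l)"
      using filter_leD[OF at_le[of "{..<l}" UNIV l] good, simplified]
        filter_leD[OF at_le[of "{..<l}" UNIV l] order_tendstoD(2)[OF G_cont \<open>G l < a\<close>], simplified]
      by eventually_elim auto
    then obtain l' where l': "l' < l" "g l' \<longlonglongrightarrow> G l'" "0 < l'" "G l' < a"
      using eventually_happens'[OF trivial_limit_at_left_real] by blast
    note dev = critical_draws_deviation[OF l l'(3), of m, folded err_def]
    have "(\<lambda>n. g l' n + err l' n) \<longlonglongrightarrow> G l' + 0"
      using l' by (intro tendsto_add dev) auto
    then have "eventually (\<lambda>n. g l' n + err l' n < a) sequentially"
      using l' by (intro order_tendstoD(2)) auto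
    then show "eventually (\<lambda>n. rare n (j n) (z n) (critical_draws m l n) < a) sequentially"
      using dev(3)[OF less_imp_neq[OF l'(1), symmetric] l'(1)] eventually_critical_time_pos[of m l'] eventually_gt_at_top[of 0]
    proof eventually_elim
      case (elim n)
      interpret coupon_collector "M n" n "C n"
        by (rule coupons) (use elim in simp)
      have "rare_prob (j n) (z n) (critical_draws m l n) \<le> g l' n + err l' n"
        unfolding g_def err_def using elim l l' by (intro rare_prob_depoissonization(2)) auto
      then show ?case
        using elim by linarith
    qed
  qed
qed

end

section \<open>Comparing the collection time with fixed times\<close>

lemma rare_types_eq_0_iff:
  assumes "1 \<le> m"
  shows "rare_types n (m - 1) a = 0 \<longleftrightarrow> (\<forall>i<n. m \<le> a i)"
proof -
  have "rare_types n (m - 1) a = 0 \<longleftrightarrow> {i. i < n \<and> a i \<le> m - 1} = {}"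
    unfolding rare_types_def by (rule card_0_eq) simp
  moreover have "x \<le> m - 1 \<longleftrightarrow> \<not> m \<le> x" for x
    using assms by linarith
  ultimately show ?thesis
    by auto
qed

text \<open>This writes the number of \<open>k\<close>-tons as a difference of two quantities that are monotone in time.\<close>

lemma num_tons_plus_rare_types:
  assumes "1 \<le> k"
  shows "num_tons m n k x + rare_types n (k - 1) (copies x (collection_time m n x)) =
    rare_types n k (copies x (collection_time m n x))"
proof -
  let ?a = "copies x (collection_time m n x)"
  have "{i. i < n \<and> ?a i \<le> k} = {i. i < n \<and> ?a i = k} \<union> {i. i < n \<and> ?a i \<le> k - 1}"
    using assms by auto
  moreover have "card ({i. i < n \<and> ?a i = k} \<union> {i. i < n \<and> ?a i \<le> k - 1}) =
      card {i. i < n \<and> ?a i = k} + card {i. i < n \<and> ?a i \<le> k - 1}"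
    using assms by (intro card_Un_disjoint) auto
  ultimately show ?thesis
    by (simp add: num_tons_def rare_types_def)
qed

text \<open>The witness \<open>t'\<close> of completion guarantees that the least completion time exists.\<close>

lemma collection_time_between:
  assumes m: "1 \<le> m"
    and "rare_types n (m - 1) (copies x t) \<noteq> 0" "rare_types n (m - 1) (copies x t') = 0"
  shows "t \<le> collection_time m n x" "collection_time m n x \<le> t'"
proof -
  define D where "D u \<longleftrightarrow> (\<forall>i<n. m \<le> copies x u i)" for u
  have D: "D u \<longleftrightarrow> rare_types n (m - 1) (copies x u) = 0" for u
    unfolding D_def using rare_types_eq_0_iff[OF m] by simp
  have T: "collection_time m n x = (LEAST u. D u)"
    by (simp add: collection_time_def D_def)
  have "D t'"
    using assms D by simp
  then show "collection_time m n x \<le> t'"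
    unfolding T by (rule Least_le)
  have "D (collection_time m n x)"
    unfolding T using \<open>D t'\<close> by (rule LeastI)
  then have "\<not> collection_time m n x \<le> t"
    using rare_types_antimono[OF copies_mono, of "collection_time m n x" t n "m - 1" x] assms D by auto
  then show "t \<le> collection_time m n x"
    by simp
qed

lemma num_tons_le_rare_types:
  assumes "1 \<le> m" "1 \<le> k"
    and "rare_types n (m - 1) (copies x t) \<noteq> 0" "rare_types n (m - 1) (copies x t') = 0"
  shows "num_tons m n k x \<le> rare_types n k (copies x t)"
  using num_tons_plus_rare_types[of k m n x] assms(2)
    rare_types_antimono[OF copies_mono[OF collection_time_between(1)[OF assms(1,3,4)], of x], of n k] by linarith

lemma rare_types_le_num_tons:
  assumes "1 \<le> m" "1 \<le> k"
    and "rare_types n (m - 1) (copies x t) \<noteq> 0" "rare_types n (m - 1) (copies x t') = 0"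
  shows "rare_types n k (copies x t') \<le> num_tons m n k x + rare_types n (k - 1) (copies x t)"
  using num_tons_plus_rare_types[of k m n x] assms(2)
    rare_types_antimono[OF copies_mono[OF collection_time_between(1)[OF assms(1,3,4)], of x], of n "k - 1"]
    rare_types_antimono[OF copies_mono[OF collection_time_between(2)[OF assms(1,3,4)], of x], of n k] by linarith

context coupon_collector
begin

lemma num_tons_measurable [measurable]:
  "(\<lambda>\<omega>. num_tons m n k (\<lambda>t. C t \<omega>)) \<in> M \<rightarrow>\<^sub>M count_space UNIV"
  unfolding num_tons_def
proof (rule measurable_compose_countable[where g = "\<lambda>\<omega>. collection_time m n (\<lambda>t. C t \<omega>)"
      and f = "\<lambda>u \<omega>. card {i. i < n \<and> copies (\<lambda>t. C t \<omega>) u i = k}"])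
  show "(\<lambda>\<omega>. card {i. i < n \<and> copies (\<lambda>t. C t \<omega>) u i = k}) \<in> M \<rightarrow>\<^sub>M count_space UNIV" for u
    by (rule copies_fun_measurable[where F = "\<lambda>a. card {i. i < n \<and> a i = k}"])
  show "(\<lambda>\<omega>. collection_time m n (\<lambda>t. C t \<omega>)) \<in> M \<rightarrow>\<^sub>M count_space UNIV"
    unfolding collection_time_def
    by (rule measurable_Least) (rule copies_fun_measurable[where F = "\<lambda>a. \<forall>i<n. m \<le> a i"])
qed

definition num_tons_prob :: "nat \<Rightarrow> nat \<Rightarrow> real \<Rightarrow> real" where
  "num_tons_prob m k y = prob {\<omega> \<in> space M. real (num_tons m n k (\<lambda>t. C t \<omega>)) \<le> y}"

text \<open>If collecting is complete at \<open>t'\<close> but not at \<open>t\<close>, it stops between these times, and the number of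
  \<open>k\<close>-tons is bounded by the number of types with at most \<open>k\<close> copies at the earlier time \<open>t\<close>.\<close>

lemma num_tons_prob_ge:
  assumes m: "1 \<le> m" and k: "1 \<le> k"
  shows "rare_prob (m - 1) 0 t' - rare_prob (m - 1) 0 t - (1 - rare_prob k y t) \<le> num_tons_prob m k y"
proof -
  let ?R = "\<lambda>j z t. {\<omega> \<in> space M. real (rare_types n j (copies (\<lambda>t. C t \<omega>) t)) \<le> z}"
  let ?S = "{\<omega> \<in> space M. real (num_tons m n k (\<lambda>t. C t \<omega>)) \<le> y}"
  have S [measurable]: "?S \<in> events"
    by simp
  note meas = sets.Un sets.Diff sets.top rare_measurable S
  have "?R (m - 1) 0 t' \<subseteq> ?S \<union> (?R (m - 1) 0 t \<union> (space M - ?R k y t))"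
  proof
    fix \<omega> assume R: "\<omega> \<in> ?R (m - 1) 0 t'"
    show "\<omega> \<in> ?S \<union> (?R (m - 1) 0 t \<union> (space M - ?R k y t))"
    proof (rule ccontr)
      assume "\<omega> \<notin> ?S \<union> (?R (m - 1) 0 t \<union> (space M - ?R k y t))"
      then have *: "\<not> real (num_tons m n k (\<lambda>t. C t \<omega>)) \<le> y"
        "\<not> real (rare_types n (m - 1) (copies (\<lambda>t. C t \<omega>) t)) \<le> 0"
        "real (rare_types n k (copies (\<lambda>t. C t \<omega>) t)) \<le> y"
        using R by auto
      then show False
        using num_tons_le_rare_types[OF m k, of n "\<lambda>t. C t \<omega>" t t'] R by auto
    qed
  qed
  then have "prob (?R (m - 1) 0 t') \<le> prob (?S \<union> (?R (m - 1) 0 t \<union> (space M - ?R k y t)))"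
    by (rule finite_measure_mono) (intro meas)
  also have "\<dots> \<le> prob ?S + prob (?R (m - 1) 0 t \<union> (space M - ?R k y t))"
    by (rule measure_Un_le) (intro meas)+
  also have "prob (?R (m - 1) 0 t \<union> (space M - ?R k y t)) \<le> prob (?R (m - 1) 0 t) + prob (space M - ?R k y t)"
    by (rule measure_Un_le) (intro meas)+
  also have "prob (space M - ?R k y t) = 1 - prob (?R k y t)"
    by (rule prob_compl) (intro meas)
  finally show ?thesis
    by (simp add: rare_prob_def num_tons_prob_def)
qed

text \<open>Here \<open>t\<close> is an early time, before completion, and \<open>t'\<close> a time after completion. At completion at least as many
  types have at most \<open>k\<close> copies as at \<open>t'\<close>, and at most as many have at most \<open>k - 1\<close> copies as at \<open>t\<close>.\<close>

lemma num_tons_prob_le: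
  assumes m: "1 \<le> m" and k: "1 \<le> k"
  shows "num_tons_prob m k y \<le> (1 - rare_prob (m - 1) 0 t') + rare_prob (m - 1) 0 t
    + rare_prob k (y + z) t' + (1 - rare_prob (k - 1) z t)"
proof -
  let ?R = "\<lambda>j z t. {\<omega> \<in> space M. real (rare_types n j (copies (\<lambda>t. C t \<omega>) t)) \<le> z}"
  let ?S = "{\<omega> \<in> space M. real (num_tons m n k (\<lambda>t. C t \<omega>)) \<le> y}"
  let ?A = "space M - ?R (m - 1) 0 t'" and ?B = "?R (m - 1) 0 t"
    and ?E = "?R k (y + z) t'" and ?F = "space M - ?R (k - 1) z t"
  have S [measurable]: "?S \<in> events"
    by simp
  note meas = sets.Un sets.Diff sets.top rare_measurable S
  have "?S \<subseteq> (?A \<union> ?B) \<union> (?E \<union> ?F)"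
  proof
    fix \<omega> assume S: "\<omega> \<in> ?S"
    show "\<omega> \<in> (?A \<union> ?B) \<union> (?E \<union> ?F)"
    proof (rule ccontr)
      assume "\<omega> \<notin> (?A \<union> ?B) \<union> (?E \<union> ?F)"
      then have *: "real (rare_types n (m - 1) (copies (\<lambda>t. C t \<omega>) t')) \<le> 0"
        "\<not> real (rare_types n (m - 1) (copies (\<lambda>t. C t \<omega>) t)) \<le> 0"
        "\<not> real (rare_types n k (copies (\<lambda>t. C t \<omega>) t')) \<le> y + z"
        "real (rare_types n (k - 1) (copies (\<lambda>t. C t \<omega>) t)) \<le> z"
        using S by auto
      then show False
        using rare_types_le_num_tons[OF m k, of n "\<lambda>t. C t \<omega>" t t'] S by auto
    qed
  qed
  then have "prob ?S \<le> prob ((?A \<union> ?B) \<union> (?E \<union> ?F))"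
    by (rule finite_measure_mono) (intro meas)
  also have "\<dots> \<le> prob (?A \<union> ?B) + prob (?E \<union> ?F)"
    by (rule measure_Un_le) (intro meas)+
  also have "\<dots> \<le> (prob ?A + prob ?B) + (prob ?E + prob ?F)"
    by (intro add_mono measure_Un_le meas)
  also have "prob ?A = 1 - prob (?R (m - 1) 0 t')"
    by (rule prob_compl) (intro meas)
  also have "prob ?F = 1 - prob (?R (k - 1) z t)"
    by (rule prob_compl) (intro meas)
  finally show ?thesis
    by (simp add: rare_prob_def num_tons_prob_def)
qed

end

section \<open>The limit law\<close>

lemma exponential_cdf:
  assumes "0 < l"
  shows "cdf (density lborel (exponential_density l)) y = (if 0 \<le> y then 1 - exp (- l * y) else 0)"
proof -
  interpret E: prob_space "density lborel (exponential_density l)"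
    using assms by (rule prob_space_exponential_density)
  have "emeasure (density lborel (erlang_density 0 l)) {..y} = erlang_CDF 0 l y"
    by (rule emeasure_erlang_density) (use assms in simp_all)
  moreover have "0 \<le> erlang_CDF 0 l y"
    using assms by (simp add: erlang_CDF_0)
  ultimately show ?thesis
    by (simp add: cdf_def measure_def erlang_CDF_0)
qed

text \<open>The growth conditions for \<open>m = 1\<close> and \<open>m \<ge> 2\<close> in a common form: for \<open>m = 1\<close> the second limit is trivial, and
  for \<open>m \<ge> 2\<close> it implies the first.\<close>

locale coupon_collectors_moderate_ton = coupon_collectors M C
  for M :: "nat \<Rightarrow> 'a measure" and C :: "nat \<Rightarrow> nat \<Rightarrow> 'a \<Rightarrow> nat" +
  fixes m :: nat and k :: "nat \<Rightarrow> nat"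
  assumes m: "1 \<le> m"
    and k_ge: "\<And>n. n \<ge> 1 \<Longrightarrow> m \<le> k n"
    and k_over_ln: "(\<lambda>n. real (k n) / ln (real n)) \<longlonglongrightarrow> 0"
    and k_lnln_over_ln:
      "(\<lambda>n. real (m - 1) * (real (k n) * ln (ln (real n)) / ln (real n))) \<longlonglongrightarrow> 0"
begin

lemma eventually_k_ge: "eventually (\<lambda>n. m \<le> k n) sequentially"
  using eventually_ge_at_top[of 1] by eventually_elim (rule k_ge)

lemma eventually_scale_pos: "eventually (\<lambda>n. 0 < ton_scale m (k n) n) sequentially"
  using eventually_ln_nat_gt[of 0] by eventually_elim (simp add: ton_scale_def)

lemma scale_tendsto_0: "(\<lambda>n. ton_scale m (k n) n) \<longlonglongrightarrow> 0"
  using m eventually_k_ge k_over_ln by (rule ton_scale_tendsto_0)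

text \<open>Collecting is complete when no type has fewer than \<open>m\<close> copies; this is the case \<open>k = m - 1\<close> of the mean
  computation, where the scale is the constant \<open>(m - 1)!\<close>.\<close>

lemma completion_limit:
  assumes "0 < l"
  shows "(\<lambda>n. rare n (m - 1) 0 (critical_draws m l n)) \<longlonglongrightarrow> exp (- l)"
proof (rule rare_prob_limit[OF assms])
  have mean: "(\<lambda>n. real n * poisson_cdf (critical_time m l' n) (m - 1)) \<longlonglongrightarrow> l'" if "0 < l'" for l'
  proof -
    have "(\<lambda>n. real (m - 1) * (1 / ln (real n))) \<longlonglongrightarrow> real (m - 1) * 0"
      by (intro tendsto_intros; real_asymp)
    moreover have "(\<lambda>n. real (m - 1) * (real (m - 1) * (ln (ln (real n)) / ln (real n))))
        \<longlonglongrightarrow> real (m - 1) * (real (m - 1) * 0)"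
      by (intro tendsto_intros; real_asymp)
    ultimately have "(\<lambda>n. ton_scale m (m - 1) n *
        (real n * poisson_cdf (critical_time m l' n) (m - 1)) / fact (m - 1)) \<longlonglongrightarrow> fact (m - 1) * l' / fact (m - 1)"
      using that by (intro tendsto_divide tendsto_const scaled_mean_rare_types) simp_all
    moreover have "eventually (\<lambda>n. ton_scale m (m - 1) n *
        (real n * poisson_cdf (critical_time m l' n) (m - 1)) / fact (m - 1) =
        real n * poisson_cdf (critical_time m l' n) (m - 1)) sequentially"
      using eventually_ln_nat_gt[of 0] by eventually_elim (simp add: ton_scale_def)
    ultimately show ?thesis
      by (simp add: tendsto_cong)
  qed
  have "eventually (\<lambda>l'. 0 < l') (at l)"
    using order_tendstoD(1)[OF tendsto_ident_at assms] .
  then show "eventually (\<lambda>l'. (\<lambda>n. measure_pmf.prob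
      (binomial_pmf n (poisson_cdf (critical_time m l' n) (m - 1))) {r. real r \<le> 0})
      \<longlonglongrightarrow> exp (- l')) (at l)"
    by eventually_elim (intro binomial_zero_limit poisson_cdf_in_unit mean)
  show "isCont (\<lambda>l. exp (- l)) l"
    by (intro continuous_intros)
qed

lemma rare_types_concentration:
  assumes "0 < l"
  shows "y < fact (m - 1) * l \<Longrightarrow>
      (\<lambda>n. rare n (k n) (y / ton_scale m (k n) n) (critical_draws m l n)) \<longlonglongrightarrow> 0"
    and "fact (m - 1) * l < y \<Longrightarrow>
      (\<lambda>n. rare n (k n) (y / ton_scale m (k n) n) (critical_draws m l n)) \<longlonglongrightarrow> 1"
proof -
  have pos: "eventually (\<lambda>l'. 0 < l') (at l)"
    using order_tendstoD(1)[OF tendsto_ident_at assms] .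
  have lim: "((\<lambda>l'. fact (m - 1) * l') \<longlongrightarrow> fact (m - 1) * l) (at l)"
    by (intro tendsto_intros)
  {
    assume "y < fact (m - 1) * l"
    from pos order_tendstoD(1)[OF lim this]
    have "eventually (\<lambda>l'. (\<lambda>n. measure_pmf.prob
        (binomial_pmf n (poisson_cdf (critical_time m l' n) (k n))) {r. real r \<le> y / ton_scale m (k n) n})
        \<longlonglongrightarrow> 0) (at l)"
      by eventually_elim (rule binomial_below_mean[OF poisson_cdf_in_unit eventually_scale_pos
          scale_tendsto_0 scaled_mean_rare_types[OF _ k_over_ln k_lnln_over_ln]])
    then show "(\<lambda>n. rare n (k n) (y / ton_scale m (k n) n) (critical_draws m l n)) \<longlonglongrightarrow> 0"
      by (rule rare_prob_limit[OF assms]) simp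
  }
  {
    assume "fact (m - 1) * l < y"
    from pos order_tendstoD(2)[OF lim this]
    have "eventually (\<lambda>l'. (\<lambda>n. measure_pmf.prob
        (binomial_pmf n (poisson_cdf (critical_time m l' n) (k n))) {r. real r \<le> y / ton_scale m (k n) n})
        \<longlonglongrightarrow> 1) (at l)"
      by eventually_elim (rule binomial_above_mean[OF poisson_cdf_in_unit eventually_scale_pos
          scale_tendsto_0 scaled_mean_rare_types[OF _ k_over_ln k_lnln_over_ln]])
    then show "(\<lambda>n. rare n (k n) (y / ton_scale m (k n) n) (critical_draws m l n)) \<longlonglongrightarrow> 1"
      by (rule rare_prob_limit[OF assms]) simp
  }
qed

lemma rarer_types_negligible:
  assumes "0 < l" "0 < z"
  shows "(\<lambda>n. rare n (k n - 1) (z / ton_scale m (k n) n) (critical_draws m l n)) \<longlonglongrightarrow> 1"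
proof (rule rare_prob_limit[OF assms(1)])
  have k0: "eventually (\<lambda>n. 1 \<le> k n) sequentially"
    using eventually_k_ge by eventually_elim (use m in simp)
  have "eventually (\<lambda>l'. 0 < l') (at l)"
    using order_tendstoD(1)[OF tendsto_ident_at assms(1)] .
  then show "eventually (\<lambda>l'. (\<lambda>n. measure_pmf.prob
      (binomial_pmf n (poisson_cdf (critical_time m l' n) (k n - 1))) {r. real r \<le> z / ton_scale m (k n) n})
      \<longlonglongrightarrow> 1) (at l)"
    by eventually_elim (rule binomial_above_mean[OF poisson_cdf_in_unit eventually_scale_pos
        scale_tendsto_0 scaled_mean_rarer_types[OF _ k0 k_over_ln k_lnln_over_ln] assms(2)])
qed simp

abbreviation "tons n \<equiv> coupon_collector.num_tons_prob (M n) n (C n) m (k n)"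

text \<open>Put \<open>l = y / (m - 1)!\<close>. By concentration, the number of types with at most \<open>k\<close> copies crosses the level
  \<open>y / ton_scale m (k n) n\<close> at the critical time with parameter \<open>l\<close>, so the event that there are at most that
  many \<open>k\<close>-tons is essentially the event that collecting is still incomplete at this time. Parameters \<open>l'\<close>
  close to \<open>l\<close> give room for concentration. The parameter \<open>\<Lambda>\<close> is large, giving a time before which
  completion is unlikely; \<open>\<eta>\<close> is small, giving a time by which completion is almost certain.\<close>

lemma num_tons_limit:
  assumes y: "0 \<le> y"
  shows "(\<lambda>n. tons n (y / ton_scale m (k n) n)) \<longlonglongrightarrow> 1 - exp (- (y / fact (m - 1)))"
proof (rule order_tendstoI)
  define l where "l = y / fact (m - 1)"
  have y_eq: "y = fact (m - 1) * l" and l: "0 \<le> l"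
    using y by (simp_all add: l_def)
  {
    fix a assume a: "1 - exp (- (y / fact (m - 1))) < a"
    have "((\<lambda>l'. 1 - exp (- l')) \<longlongrightarrow> 1 - exp (- l)) (at_right l)"
      by (intro tendsto_intros)
    then have "eventually (\<lambda>l'. 1 - exp (- l') < a) (at_right l)"
      using a by (intro order_tendstoD(2)) (auto simp: l_def)
    then have "eventually (\<lambda>l'. l < l' \<and> 1 - exp (- l') < a) (at_right l)"
      using eventually_at_right_less[of l] by eventually_elim simp
    then obtain l' where l': "l < l'" "1 - exp (- l') < a"
      using eventually_happens'[OF trivial_limit_at_right_real] by blast
    have "((\<lambda>\<Lambda>::real. exp (- \<Lambda>)) \<longlongrightarrow> 0) at_top"
      by real_asymp
    then have "eventually (\<lambda>\<Lambda>. exp (- \<Lambda>) < a - (1 - exp (- l'))) at_top"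
      using l' by (intro order_tendstoD(2)) auto
    then have "eventually (\<lambda>\<Lambda>. 0 < \<Lambda> \<and> exp (- \<Lambda>) < a - (1 - exp (- l'))) at_top"
      using eventually_gt_at_top[of 0] by eventually_elim simp
    then obtain \<Lambda> where \<Lambda>: "0 < \<Lambda>" "exp (- \<Lambda>) < a - (1 - exp (- l'))"
      using eventually_happens'[OF trivial_limit_at_top_linorder] by blast
    \<comment> \<open>Half of the gap between the level \<open>y\<close> and the concentration point \<open>(m - 1)! l'\<close> is left for the
      types with at most \<open>k - 1\<close> copies.\<close>
    define z where "z = fact (m - 1) * (l' - l) / 2"
    have z: "0 < z" "y + z < fact (m - 1) * l'"
      using l' by (simp_all add: z_def y_eq field_simps)
    define U where "U n = (1 - rare n (m - 1) 0 (critical_draws m l' n))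
      + rare n (m - 1) 0 (critical_draws m \<Lambda> n)
      + rare n (k n) ((y + z) / ton_scale m (k n) n) (critical_draws m l' n)
      + (1 - rare n (k n - 1) (z / ton_scale m (k n) n) (critical_draws m \<Lambda> n))" for n
    have "U \<longlonglongrightarrow> (1 - exp (- l')) + exp (- \<Lambda>) + 0 + (1 - 1)"
      unfolding U_def[abs_def] using l l' \<Lambda> z
      by (intro tendsto_intros completion_limit rare_types_concentration rarer_types_negligible) auto
    then have "eventually (\<lambda>n. U n < a) sequentially"
      using \<Lambda> by (intro order_tendstoD(2)) auto
    then show "eventually (\<lambda>n. tons n (y / ton_scale m (k n) n) < a) sequentially"
      using eventually_ge_at_top[of 1]
    proof eventually_elim
      case (elim n)
      interpret coupon_collector "M n" n "C n"
        by (rule coupons) (use elim in simp)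
      have "num_tons_prob m (k n) (y / ton_scale m (k n) n) \<le> U n"
        unfolding U_def add_divide_distrib using m k_ge[of n] elim by (intro num_tons_prob_le) auto
      then show ?case
        using elim by linarith
    qed
  }
  {
    fix a assume a: "a < 1 - exp (- (y / fact (m - 1)))"
    \<comment> \<open>For \<open>y = 0\<close> there is no parameter below \<open>l = 0\<close>, but then the bound is trivial.\<close>
    show "eventually (\<lambda>n. a < tons n (y / ton_scale m (k n) n)) sequentially"
    proof (cases "y = 0")
      case True
      show ?thesis
        using eventually_ge_at_top[of 1]
      proof eventually_elim
        case (elim n)
        interpret coupon_collector "M n" n "C n"
          by (rule coupons) (use elim in simp)
        show ?case
          using a True unfolding num_tons_prob_def by (simp add: less_le_trans[OF _ measure_nonneg])
      qed
    next
      case False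
      then have l_pos: "0 < l"
        using y by (simp add: l_def)
      have "((\<lambda>l'. 1 - exp (- l')) \<longlongrightarrow> 1 - exp (- l)) (at_left l)"
        by (intro tendsto_intros)
      then have "eventually (\<lambda>l'. a < 1 - exp (- l')) (at_left l)"
        using a by (intro order_tendstoD(1)) (auto simp: l_def)
      then have "eventually (\<lambda>l'. l' \<in> {0<..<l} \<and> a < 1 - exp (- l')) (at_left l)"
        using eventually_at_left_real[OF l_pos] by eventually_elim simp
      then obtain l' where l': "0 < l'" "l' < l" "a < 1 - exp (- l')"
        using eventually_happens'[OF trivial_limit_at_left_real] by auto
      have "((\<lambda>\<eta>::real. exp (- \<eta>)) \<longlongrightarrow> exp (- 0)) (at_right 0)"
        by (intro tendsto_intros)
      then have "eventually (\<lambda>\<eta>. a + exp (- l') < exp (- \<eta>)) (at_right 0)"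
        using l' by (intro order_tendstoD(1)) auto
      then have "eventually (\<lambda>\<eta>. 0 < \<eta> \<and> a + exp (- l') < exp (- \<eta>)) (at_right 0)"
        using eventually_at_right_less[of 0] by eventually_elim simp
      then obtain \<eta> where \<eta>: "0 < \<eta>" "a + exp (- l') < exp (- \<eta>)"
        using eventually_happens'[OF trivial_limit_at_right_real] by blast
      define V where "V n = rare n (m - 1) 0 (critical_draws m \<eta> n)
        - rare n (m - 1) 0 (critical_draws m l' n)
        - (1 - rare n (k n) (y / ton_scale m (k n) n) (critical_draws m l' n))" for n
      have "fact (m - 1) * l' < y"
        using l' by (simp add: y_eq)
      then have "V \<longlonglongrightarrow> exp (- \<eta>) - exp (- l') - (1 - 1)"
        unfolding V_def[abs_def] using l' \<eta>
        by (intro tendsto_intros completion_limit rare_types_concentration) auto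
      then have "eventually (\<lambda>n. a < V n) sequentially"
        using \<eta> by (intro order_tendstoD(1)) auto
      then show ?thesis
        using eventually_ge_at_top[of 1]
      proof eventually_elim
        case (elim n)
        interpret coupon_collector "M n" n "C n"
          by (rule coupons) (use elim in simp)
        have "V n \<le> num_tons_prob m (k n) (y / ton_scale m (k n) n)"
          unfolding V_def using m k_ge[of n] elim by (intro num_tons_prob_ge) auto
        then show ?case
          using elim by linarith
      qed
    qed
  }
qed

end

theorem corollary1p1:
  fixes m :: nat and k :: "nat \<Rightarrow> nat"
    and M :: "nat \<Rightarrow> 'a measure" and C :: "nat \<Rightarrow> nat \<Rightarrow> 'a \<Rightarrow> nat"
  assumes m: "m \<ge> 1"
    and coupons: "\<And>n. n \<ge> 1 \<Longrightarrow> coupon_collector (M n) n (C n)"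
    and k_ge: "\<And>n. n \<ge> 1 \<Longrightarrow> k n \<ge> m"
    and k_small_1: "m = 1 \<Longrightarrow> (\<lambda>n. real (k n)) \<in> o(\<lambda>n. ln (real n))"
    and k_small_2: "m \<ge> 2 \<Longrightarrow> (\<lambda>n. real (k n)) \<in> o(\<lambda>n. ln (real n) / ln (ln (real n)))"
  shows "weak_conv_m
    (\<lambda>n. distr (M n) borel
      (\<lambda>\<omega>. fact (k n) * real (num_tons m n (k n) (\<lambda>t. C n t \<omega>)) / ln (real n) ^ (k n - m + 1)))
    (density lborel (exponential_density (1 / fact (m - 1))))"
proof -
  have k_ln: "(\<lambda>n. real (k n) / ln (real n)) \<longlonglongrightarrow> 0
      \<and> (\<lambda>n. real (m - 1) * (real (k n) * ln (ln (real n)) / ln (real n))) \<longlonglongrightarrow> 0"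
  proof (cases "m = 1")
    case True
    then show ?thesis
      using smalloD_tendsto[OF k_small_1] by simp
  next
    case False
    then have "2 \<le> m"
      using m by simp
    then have lnln: "(\<lambda>n. real (k n) * ln (ln (real n)) / ln (real n)) \<longlonglongrightarrow> 0"
      using smalloD_tendsto[OF k_small_2] by simp
    have "(\<lambda>n. real (k n) / ln (real n)) \<longlonglongrightarrow> 0"
    proof (rule Lim_null_comparison[OF _ lnln])
      show "eventually (\<lambda>n. norm (real (k n) / ln (real n)) \<le> real (k n) * ln (ln (real n)) / ln (real n)) sequentially"
        using eventually_ln_nat_gt[of "exp 1"]
      proof eventually_elim
        case (elim n)
        have pos: "0 < ln (real n)"
          using elim exp_gt_zero[of "1 :: real"] by linarith
        then have "1 \<le> ln (ln (real n))"
          using elim by (simp add: ln_ge_iff)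
        then have "real (k n) * 1 \<le> real (k n) * ln (ln (real n))"
          by (intro mult_left_mono) auto
        then show ?case
          using pos by (simp add: divide_right_mono)
      qed
    qed
    moreover have "(\<lambda>n. real (m - 1) * (real (k n) * ln (ln (real n)) / ln (real n))) \<longlonglongrightarrow> real (m - 1) * 0"
      by (intro tendsto_intros lnln)
    ultimately show ?thesis
      by simp
  qed
  interpret coupon_collectors_moderate_ton M C m k
    using m coupons k_ge k_ln
    by (intro coupon_collectors_moderate_ton.intro coupon_collectors.intro
        coupon_collectors_moderate_ton_axioms.intro) simp_all
  define X where "X n \<omega> = fact (k n) * real (num_tons m n (k n) (\<lambda>t. C n t \<omega>)) / ln (real n) ^ (k n - m + 1)"
    for n \<omega>
  let ?E = "density lborel (exponential_density (1 / fact (m - 1)))"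
  have cdf: "eventually (\<lambda>n. cdf (distr (M n) borel (X n)) y =
      tons n (y / ton_scale m (k n) n)) sequentially" for y
    using eventually_ge_at_top[of 1] eventually_ln_nat_gt[of 0]
  proof eventually_elim
    case (elim n)
    interpret coupon_collector "M n" n "C n"
      by (rule coupons) (use elim in simp)
    have "k n = (m - 1) + (k n - m + 1)"
      using m k_ge[of n] elim by simp
    then have "ln (real n) ^ k n = ln (real n) ^ (m - 1) * ln (real n) ^ (k n - m + 1)"
      by (metis power_add)
    then have scale: "ton_scale m (k n) n = fact (k n) / ln (real n) ^ (k n - m + 1)"
      using elim by (simp add: ton_scale_def)
    have scale_pos: "0 < ton_scale m (k n) n"
      using elim unfolding scale by simp
    have X_eq: "X n \<omega> = ton_scale m (k n) n * real (num_tons m n (k n) (\<lambda>t. C n t \<omega>))" for \<omega>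
      by (simp add: X_def scale)
    have "X n \<in> borel_measurable (M n)"
      unfolding X_eq[abs_def] by measurable
    then have "cdf (distr (M n) borel (X n)) y = prob {\<omega> \<in> space (M n). X n \<omega> \<le> y}"
      by (simp add: cdf_def measure_distr vimage_def Int_def conj_commute)
    also have "\<dots> = num_tons_prob m (k n) (y / ton_scale m (k n) n)"
      unfolding num_tons_prob_def X_eq using scale_pos by (simp add: pos_le_divide_eq mult.commute)
    finally show ?case .
  qed
  have "(\<lambda>n. cdf (distr (M n) borel (X n)) y) \<longlonglongrightarrow> cdf ?E y" for y
  proof (cases "0 \<le> y")
    case True
    then have "(\<lambda>n. tons n (y / ton_scale m (k n) n)) \<longlonglongrightarrow> cdf ?E y"
      using num_tons_limit[OF True] by (simp add: exponential_cdf)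
    then show ?thesis
      using cdf[of y] by (simp add: tendsto_cong)
  next
    case False
    have "eventually (\<lambda>n. tons n (y / ton_scale m (k n) n) = 0) sequentially"
      using eventually_ge_at_top[of 1] eventually_scale_pos
    proof eventually_elim
      case (elim n)
      interpret coupon_collector "M n" n "C n"
        by (rule coupons) (use elim in simp)
      have "y / ton_scale m (k n) n < 0"
        using False elim by (simp add: divide_neg_pos)
      then have "{\<omega> \<in> space (M n). real (num_tons m n (k n) (\<lambda>t. C n t \<omega>)) \<le> y / ton_scale m (k n) n} = {}"
        by (auto simp: not_le intro: less_le_trans)
      then show ?case
        unfolding num_tons_prob_def by (simp only: measure_empty)
    qed
    with cdf[of y] have "eventually (\<lambda>n. cdf (distr (M n) borel (X n)) y = 0) sequentially"
      by eventually_elim simp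
    then show ?thesis
      using False by (simp add: tendsto_cong exponential_cdf)
  qed
  then show ?thesis
    by (simp add: weak_conv_m_def weak_conv_def X_def[abs_def])
qed

end
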